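(* Let $R=\mathbb Z[u_{s,i}^{\pm1},u_{t,j}^{\pm1},u_{u,l}^{\pm1}]_{1\le i\le 2,\,1\le j\le 3,\,1\le l\le 4}$ and let $$H_{G_{11}}=\Big\langle s,t,u\ \Big|\ stu=tus=ust,\ \prod_{i=1}^2(s-u_{s,i})=\prod_{j=1}^3(t-u_{t,j})=\prod_{l=1}^4(u-u_{u,l})=0\Big\rangle$$ be the generic Hecke algebra (an associative unital $R$-algebra) of $G_{11}$. Let $u_2,u_3$ be the $R$-subalgebras generated by $t$ and by $u$ respectively, let $z=stu$, and let $$U=\sum_{k=0}^{23}\big(z^ku_3u_2+z^ku_3tu^{-1}u_2\big).$$ Then: (i) for every $k\in\{0,\dots,23\}$, $z^ktu_3\subset U$; (ii) for every $k\in\{0,\dots,23\}$, $z^ktu_3tu^{-1}\subset U$; (iii) $H_{G_{11}}=U$.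
   Context: For subsets $X,Y$ of an $R$-algebra, $XY$ denotes the $R$-submodule spanned by the products $xy$. The generators are invertible in the algebra because the parameters are invertible in $R$. *)

theory Defs
  imports Complex_Main "HOL-Library.Poly_Mapping" "HOL-Library.Set_Algebras"
begin

section \<open>The Laurent polynomial ring\<close>

datatype param = us1 | us2 | ut1 | ut2 | ut3 | uu1 | uu2 | uu3 | uu4

text \<open>
  The Laurent polynomial ring \<open>\<int>[x\<^sup>\<plusminus>\<^sup>1 | x \<in> param]\<close> is the group ring over \<open>\<int>\<close> of the free abelian
  group on \<^typ>\<open>param\<close>; an exponent vector is an element of \<open>param \<Rightarrow>\<^sub>0 int\<close>, and multiplication
  is the convolution product of \<^theory>\<open>HOL-Library.Poly_Mapping\<close>.
\<close>

type_synonym laurent = "(param \<Rightarrow>\<^sub>0 int) \<Rightarrow>\<^sub>0 int"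

definition indet :: "param \<Rightarrow> laurent" where
  "indet p = Poly_Mapping.single (Poly_Mapping.single p 1) 1"

definition indet_inv :: "param \<Rightarrow> laurent" where
  "indet_inv p = Poly_Mapping.single (Poly_Mapping.single p (- 1)) 1"

lemma indet_inverse [simp]: "indet p * indet_inv p = 1" "indet_inv p * indet p = 1"
  by (simp_all add: indet_def indet_inv_def mult_single flip: single_add)


section \<open>The free associative algebra on three generators\<close>

datatype gen = GenS | GenT | GenU

text \<open>
  The free monoid on \<^typ>\<open>gen\<close>, written additively so that the convolution product on
  \<open>word \<Rightarrow>\<^sub>0 laurent\<close> is the multiplication of the free algebra.
\<close>

datatype word = Word (letters: "gen list")

instantiation word :: monoid_add
begin

definition "0 = Word []"
definition "v + w = Word (letters v @ letters w)"

instance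
  by standard (simp_all add: zero_word_def plus_word_def)

end

type_synonym free_alg = "word \<Rightarrow>\<^sub>0 laurent"

definition free_const :: "laurent \<Rightarrow> free_alg" where
  "free_const a = Poly_Mapping.single 0 a"

definition free_gen :: "gen \<Rightarrow> free_alg" where
  "free_gen g = Poly_Mapping.single (Word [g]) 1"


section \<open>The generic Hecke algebra\<close>

definition hecke_relators :: "free_alg set" where
  "hecke_relators =
    (let s = free_gen GenS; t = free_gen GenT; u = free_gen GenU;
         c = (\<lambda>p. free_const (indet p))
     in {s * t * u - t * u * s,
         t * u * s - u * s * t,
         (s - c us1) * (s - c us2),
         (t - c ut1) * (t - c ut2) * (t - c ut3),
         (u - c uu1) * (u - c uu2) * (u - c uu3) * (u - c uu4)})"

definition two_sided_ideal :: "'a::ring set \<Rightarrow> bool" where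
  "two_sided_ideal I \<longleftrightarrow>
    0 \<in> I \<and> (\<forall>x\<in>I. \<forall>y\<in>I. x + y \<in> I) \<and> (\<forall>x\<in>I. \<forall>a. a * x \<in> I \<and> x * a \<in> I)"

definition hecke_ideal :: "free_alg set" where
  "hecke_ideal = two_sided_ideal hull hecke_relators"

lemma two_sided_ideal_hecke_ideal: "two_sided_ideal hecke_ideal"
  unfolding hecke_ideal_def by (rule hull_in) (auto simp: two_sided_ideal_def)

lemma hecke_ideal_0: "0 \<in> hecke_ideal"
  and hecke_ideal_add: "x \<in> hecke_ideal \<Longrightarrow> y \<in> hecke_ideal \<Longrightarrow> x + y \<in> hecke_ideal"
  and hecke_ideal_mult_left: "x \<in> hecke_ideal \<Longrightarrow> a * x \<in> hecke_ideal"
  and hecke_ideal_mult_right: "x \<in> hecke_ideal \<Longrightarrow> x * a \<in> hecke_ideal"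
  using two_sided_ideal_hecke_ideal by (auto simp: two_sided_ideal_def)

lemma hecke_ideal_uminus: "x \<in> hecke_ideal \<Longrightarrow> - x \<in> hecke_ideal"
  using hecke_ideal_mult_left [of x "- 1"] by simp

lemma hecke_ideal_diff: "x \<in> hecke_ideal \<Longrightarrow> y \<in> hecke_ideal \<Longrightarrow> x - y \<in> hecke_ideal"
  using hecke_ideal_add [of x "- y"] hecke_ideal_uminus [of y] by simp

lemma hecke_relators_subset: "hecke_relators \<subseteq> hecke_ideal"
  unfolding hecke_ideal_def by (rule hull_subset)

text \<open>
  The ideal is proper: the one-dimensional character sending each generator to its first
  parameter annihilates all relators.
\<close>

definition free_eval :: "(gen \<Rightarrow> laurent) \<Rightarrow> free_alg \<Rightarrow> laurent" where
  "free_eval v f =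
    (\<Sum>w\<in>Poly_Mapping.keys f. Poly_Mapping.lookup f w * prod_list (map v (letters w)))"

lemma free_eval_superset:
  assumes "finite A" "Poly_Mapping.keys f \<subseteq> A"
  shows "free_eval v f = (\<Sum>w\<in>A. Poly_Mapping.lookup f w * prod_list (map v (letters w)))"
  unfolding free_eval_def using assms
  by (intro sum.mono_neutral_left) (auto simp: in_keys_iff)

lemma free_eval_add: "free_eval v (f + g) = free_eval v f + free_eval v g"
proof -
  let ?A = "Poly_Mapping.keys f \<union> Poly_Mapping.keys g"
  have "Poly_Mapping.keys (f + g) \<subseteq> ?A"
    by (rule keys_add)
  then show ?thesis
    by (simp add: free_eval_superset [of ?A] lookup_add sum.distrib distrib_right)
qed

lemma free_eval_single:
  "free_eval v (Poly_Mapping.single w a) = a * prod_list (map v (letters w))"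
  by (simp add: free_eval_def)

lemma free_alg_induct [case_names zero add]:
  fixes f :: free_alg
  assumes zero: "P 0" and add: "\<And>w a g. P g \<Longrightarrow> P (Poly_Mapping.single w a + g)"
  shows "P f"
proof (induction f rule: update_induct)
  case const
  then show ?case by (rule zero)
next
  case (update f w a)
  have "Poly_Mapping.update w a f = Poly_Mapping.single w a + f"
    using update by (intro poly_mapping_eqI)
      (auto simp: lookup_update lookup_add lookup_single when_def in_keys_iff)
  then show ?case using update add by simp
qed

lemma free_eval_0: "free_eval v 0 = 0"
  by (simp add: free_eval_def)

lemma free_eval_single_mult:
  "free_eval v (Poly_Mapping.single w a * g) = free_eval v (Poly_Mapping.single w a) * free_eval v g"
  by (induction g rule: free_alg_induct)
    (simp_all add: free_eval_0 free_eval_add free_eval_single mult_single distrib_left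
      plus_word_def mult_ac)

lemma free_eval_mult: "free_eval v (f * g) = free_eval v f * free_eval v g"
  by (induction f rule: free_alg_induct)
    (simp_all add: free_eval_0 free_eval_add free_eval_single_mult distrib_right)

lemma free_eval_uminus: "free_eval v (- f) = - free_eval v f"
  by (simp add: free_eval_def sum_negf)

lemma free_eval_diff: "free_eval v (f - g) = free_eval v f - free_eval v g"
  using free_eval_add [of v f "- g"] by (simp add: free_eval_uminus)

lemma free_eval_1: "free_eval v 1 = 1"
  by (metis free_eval_single single_one zero_word_def word.sel list.map(1) prod_list.Nil mult_1)

lemma one_notin_hecke_ideal: "1 \<notin> hecke_ideal"
proof -
  define v where "v = (\<lambda>g. indet (case g of GenS \<Rightarrow> us1 | GenT \<Rightarrow> ut1 | GenU \<Rightarrow> uu1))"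
  have "hecke_ideal \<subseteq> {f. free_eval v f = 0}"
    unfolding hecke_ideal_def
  proof (rule hull_minimal)
    show "two_sided_ideal {f. free_eval v f = 0}"
      by (auto simp: two_sided_ideal_def free_eval_0 free_eval_add free_eval_mult)
    show "hecke_relators \<subseteq> {f. free_eval v f = 0}"
      by (auto simp: hecke_relators_def Let_def free_eval_diff free_eval_mult free_gen_def
          free_const_def free_eval_single v_def zero_word_def)
  qed
  then show ?thesis by (auto simp: free_eval_1)
qed

quotient_type hecke = free_alg / "\<lambda>f g. f - g \<in> hecke_ideal"
proof (rule equivpI)
  show "reflp (\<lambda>f g. f - g \<in> hecke_ideal)"
    by (simp add: reflp_def hecke_ideal_0)
  show "symp (\<lambda>f g. f - g \<in> hecke_ideal)"
    by (rule sympI) (metis hecke_ideal_uminus minus_diff_eq)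
  show "transp (\<lambda>f g. f - g \<in> hecke_ideal)"
  proof (rule transpI)
    fix f g h :: free_alg
    assume "f - g \<in> hecke_ideal" "g - h \<in> hecke_ideal"
    from hecke_ideal_add [OF this] show "f - h \<in> hecke_ideal" by simp
  qed
qed

instantiation hecke :: ring_1
begin

lift_definition zero_hecke :: hecke is "0" .

lift_definition one_hecke :: hecke is "1" .

lift_definition plus_hecke :: "hecke \<Rightarrow> hecke \<Rightarrow> hecke" is "(+)"
proof -
  fix a b c d :: free_alg
  assume "a - b \<in> hecke_ideal" "c - d \<in> hecke_ideal"
  then have "(a - b) + (c - d) \<in> hecke_ideal" by (rule hecke_ideal_add)
  then show "(a + c) - (b + d) \<in> hecke_ideal" by (simp add: algebra_simps)
qed

lift_definition uminus_hecke :: "hecke \<Rightarrow> hecke" is "uminus"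
  using hecke_ideal_uminus by fastforce

lift_definition minus_hecke :: "hecke \<Rightarrow> hecke \<Rightarrow> hecke" is "(-)"
proof -
  fix a b c d :: free_alg
  assume "a - b \<in> hecke_ideal" "c - d \<in> hecke_ideal"
  then have "(a - b) - (c - d) \<in> hecke_ideal" by (rule hecke_ideal_diff)
  then show "(a - c) - (b - d) \<in> hecke_ideal" by (simp add: algebra_simps)
qed

lift_definition times_hecke :: "hecke \<Rightarrow> hecke \<Rightarrow> hecke" is "(*)"
proof -
  fix a b c d :: free_alg
  assume "a - b \<in> hecke_ideal" "c - d \<in> hecke_ideal"
  then have "(a - b) * c + b * (c - d) \<in> hecke_ideal"
    by (intro hecke_ideal_add hecke_ideal_mult_left hecke_ideal_mult_right)
  then show "a * c - b * d \<in> hecke_ideal" by (simp add: algebra_simps)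
qed

instance
proof
  show "(0::hecke) \<noteq> 1"
    by transfer (metis one_notin_hecke_ideal hecke_ideal_uminus diff_0 minus_minus)
qed (transfer; simp add: algebra_simps hecke_ideal_0)+

end

lift_definition hecke_scale :: "laurent \<Rightarrow> hecke \<Rightarrow> hecke" (infixr \<open>*\<^sub>H\<close> 75)
  is "\<lambda>a f. free_const a * f"
  by (simp add: hecke_ideal_mult_left flip: right_diff_distrib)

interpretation hecke: module hecke_scale
  by standard
    (transfer; simp add: free_const_def single_add mult_single distrib_left distrib_right
      hecke_ideal_0 flip: mult.assoc)+

lemma hecke_scale_mult:
  "(a *\<^sub>H x) * y = a *\<^sub>H (x * y)" "x * (a *\<^sub>H y) = a *\<^sub>H (x * y)"
proof -
  have comm: "f * free_const a = free_const a * f" for a f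
    by (induction f rule: free_alg_induct)
      (simp_all add: free_const_def distrib_left distrib_right mult_single mult_ac)
  have left_comm: "f * (free_const a * g) = free_const a * (f * g)" for a f g
    using comm [of f a] by (simp flip: mult.assoc)
  show "(a *\<^sub>H x) * y = a *\<^sub>H (x * y)"
    by transfer (simp add: mult.assoc hecke_ideal_0)
  show "x * (a *\<^sub>H y) = a *\<^sub>H (x * y)"
    by transfer (simp add: left_comm mult.assoc hecke_ideal_0)
qed

lift_definition hs :: hecke is "free_gen GenS" .
lift_definition ht :: hecke is "free_gen GenT" .
lift_definition hu :: hecke is "free_gen GenU" .

lemma hecke_braid: "hs * ht * hu = ht * hu * hs" "ht * hu * hs = hu * hs * ht"
  using hecke_relators_subset
  by (transfer, simp add: hecke_relators_def Let_def)+

lemma hecke_poly: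
  "(hs - indet us1 *\<^sub>H 1) * (hs - indet us2 *\<^sub>H 1) = 0"
  "(ht - indet ut1 *\<^sub>H 1) * (ht - indet ut2 *\<^sub>H 1) * (ht - indet ut3 *\<^sub>H 1) = 0"
  "(hu - indet uu1 *\<^sub>H 1) * (hu - indet uu2 *\<^sub>H 1) * (hu - indet uu3 *\<^sub>H 1)
     * (hu - indet uu4 *\<^sub>H 1) = 0"
  using hecke_relators_subset
  by (transfer, simp add: hecke_relators_def Let_def)+


section \<open>Inverses\<close>

text \<open>Meaningful only if \<open>x\<close> has a two-sided inverse, which is then unique.\<close>

definition unit_inv :: "'a::monoid_mult \<Rightarrow> 'a" where
  "unit_inv x = (THE y. x * y = 1 \<and> y * x = 1)"

lemma unit_inv_eqI:
  assumes "x * y = 1" "y * x = 1"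
  shows "unit_inv x = y"
  unfolding unit_inv_def using assms
  by (intro the_equality) (auto, metis mult.assoc mult_1_left mult_1_right)

lemma hecke_prod_linear:
  "\<exists>p. prod_list (map (\<lambda>a. x - a *\<^sub>H 1) as) = x * p + prod_list (map uminus as) *\<^sub>H 1 \<and> p * x = x * p"
proof (induction as)
  case Nil
  show ?case by (rule exI [of _ 0]) simp
next
  case (Cons a as)
  then obtain p where p: "prod_list (map (\<lambda>a. x - a *\<^sub>H 1) as) = x * p + prod_list (map uminus as) *\<^sub>H 1"
    and comm: "p * x = x * p" by blast
  let ?c = "prod_list (map uminus as)"
  let ?q = "x * p + ?c *\<^sub>H 1 - a *\<^sub>H p"
  have "(x - a *\<^sub>H 1) * (x * p + ?c *\<^sub>H 1) = x * ?q + (- a * ?c) *\<^sub>H 1"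
    by (simp add: algebra_simps hecke_scale_mult)
  moreover have "?q * x = x * ?q"
    by (simp add: algebra_simps hecke_scale_mult comm)
  ultimately show ?case using p by auto
qed

lemma hecke_invertible_of_poly:
  assumes "prod_list (map (\<lambda>a. x - a *\<^sub>H 1) as) = 0" "prod_list (map uminus as) * b = 1"
  shows "\<exists>y. x * y = 1 \<and> y * x = 1"
proof -
  let ?c = "prod_list (map uminus as)"
  obtain p where p: "x * p + ?c *\<^sub>H 1 = 0" and comm: "p * x = x * p"
    using hecke_prod_linear [of x as] assms(1) by auto
  have "x * p = - (?c *\<^sub>H 1)"
    using p by (simp add: eq_neg_iff_add_eq_0)
  moreover have "b * ?c = 1"
    using assms(2) by (simp add: mult.commute)
  ultimately have "x * ((- b) *\<^sub>H p) = 1" "((- b) *\<^sub>H p) * x = 1"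
    by (simp_all add: hecke_scale_mult comm)
  then show ?thesis by blast
qed

lemma hecke_gen_invertible:
  "\<exists>y. hs * y = 1 \<and> y * hs = 1"
  "\<exists>y. ht * y = 1 \<and> y * ht = 1"
  "\<exists>y. hu * y = 1 \<and> y * hu = 1"
proof -
  have inv: "prod_list (map uminus (map indet ps)) * prod_list (map uminus (map indet_inv ps)) = 1" for ps
  proof (induction ps)
    case (Cons p ps)
    let ?A = "prod_list (map uminus (map indet ps))"
    let ?B = "prod_list (map uminus (map indet_inv ps))"
    have "indet p * ?A * (indet_inv p * ?B) = (indet p * indet_inv p) * (?A * ?B)"
      by (simp only: ac_simps)
    with Cons show ?case by simp
  qed simp
  show "\<exists>y. hs * y = 1 \<and> y * hs = 1"
    by (rule hecke_invertible_of_poly [OF _ inv [of "[us1, us2]"]]) (simp add: hecke_poly)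
  show "\<exists>y. ht * y = 1 \<and> y * ht = 1"
    by (rule hecke_invertible_of_poly [OF _ inv [of "[ut1, ut2, ut3]"]])
      (simp add: hecke_poly flip: mult.assoc)
  show "\<exists>y. hu * y = 1 \<and> y * hu = 1"
    by (rule hecke_invertible_of_poly [OF _ inv [of "[uu1, uu2, uu3, uu4]"]])
      (simp add: hecke_poly flip: mult.assoc)
qed

lemma hecke_gen_unit_inv:
  "hs * unit_inv hs = 1" "unit_inv hs * hs = 1"
  "ht * unit_inv ht = 1" "unit_inv ht * ht = 1"
  "hu * unit_inv hu = 1" "unit_inv hu * hu = 1"
  using hecke_gen_invertible unit_inv_eqI by metis+


section \<open>Submodules\<close>

definition span_prod :: "hecke set \<Rightarrow> hecke set \<Rightarrow> hecke set" (infixl \<open>\<odot>\<close> 70) where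
  "X \<odot> Y = hecke.span {x * y | x y. x \<in> X \<and> y \<in> Y}"

definition subalgebra :: "hecke set \<Rightarrow> bool" where
  "subalgebra A \<longleftrightarrow> hecke.subspace A \<and> 1 \<in> A \<and> (\<forall>x\<in>A. \<forall>y\<in>A. x * y \<in> A)"

definition alg_u2 :: "hecke set" where
  "alg_u2 = subalgebra hull {ht}"

definition alg_u3 :: "hecke set" where
  "alg_u3 = subalgebra hull {hu}"

definition hz :: hecke where
  "hz = hs * ht * hu"

text \<open>The sum of submodules is the elementwise sum of sets of \<^theory>\<open>HOL-Library.Set_Algebras\<close>.\<close>

definition mod_U :: "hecke set" where
  "mod_U = (\<Sum>k = 0..23.
     {hz ^ k} \<odot> alg_u3 \<odot> alg_u2 + {hz ^ k} \<odot> alg_u3 \<odot> {ht * unit_inv hu} \<odot> alg_u2)"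

end

theory Submission
  imports Defs
begin

text \<open>
  Since s is the product of the central element z with the inverses of u and t, the quadratic relation for s
  says that z, t u and the product of \<open>z\<^sup>2\<close> with the inverses of u and t are linearly dependent, the
  last two with unit coefficients. Likewise four consecutive powers of t, and five consecutive powers
  of u, are dependent with outer coefficients units. Hence, once all but one outer term of a relation
  (multiplied by arbitrary words on both sides) lie in U, so does the remaining one. Starting from the
  words 1 and \<open>t u\<^sup>-\<^sup>1\<close>, which lie in U with the powers \<open>z\<^sup>0, \<dots>, z\<^sup>2\<^sup>3\<close> of z, this puts
  \<open>z\<^sup>k t u\<^sup>j\<close> and \<open>z\<^sup>k t u\<^sup>j t u\<^sup>-\<^sup>1\<close> into U for four consecutive values of j and all k below 24, which
  makes U stable under left multiplication by t. Stability under u is clear and stability under s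
  follows, so U is a left ideal containing 1.
\<close>

section \<open>The Hecke algebra in the generators t, u and the central element z\<close>

lemma subalgebra_hull_subset:
  assumes "hecke.subspace A" "1 \<in> A" "\<And>x y. x \<in> A \<Longrightarrow> y \<in> A \<Longrightarrow> x * y \<in> A" "g \<in> A"
  shows "subalgebra hull {g} \<subseteq> A"
  using assms by (intro hull_minimal) (auto simp: subalgebra_def)

text \<open>Every element is the image of a linear combination of words, and a word enters
  \<open>A\<close> letter by letter. Applied to the left stabilizer of U, this reduces the whole
  theorem to stability under three generators.\<close>

lemma generators_generate:
  assumes A: "subalgebra A" and gens: "hs \<in> A" "ht \<in> A" "hu \<in> A"
  shows "A = UNIV"
proof -
  have single: "abs_hecke (Poly_Mapping.single (Word l) a) \<in> A" for l a
  proof (induction l)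
    case Nil
    have "Poly_Mapping.single (Word []) a = free_const a * 1"
      by (simp add: free_const_def zero_word_def)
    then have "abs_hecke (Poly_Mapping.single (Word []) a) = a *\<^sub>H 1"
      by (simp add: hecke_scale.abs_eq one_hecke_def)
    then show ?case
      using A by (simp add: subalgebra_def hecke.subspace_scale)
  next
    case (Cons g l)
    have "Poly_Mapping.single (Word (g # l)) a = free_gen g * Poly_Mapping.single (Word l) a"
      by (simp add: free_gen_def mult_single plus_word_def)
    then have "abs_hecke (Poly_Mapping.single (Word (g # l)) a)
        = abs_hecke (free_gen g) * abs_hecke (Poly_Mapping.single (Word l) a)"
      by (simp add: times_hecke.abs_eq)
    moreover have "abs_hecke (free_gen g) \<in> A"
      using gens by (cases g) (simp_all add: hs_def ht_def hu_def)
    ultimately show ?case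
      using A Cons by (simp add: subalgebra_def)
  qed
  have "abs_hecke f \<in> A" for f
  proof (induction f rule: free_alg_induct)
    case zero
    then show ?case
      using A by (simp add: subalgebra_def hecke.subspace_0 flip: zero_hecke_def)
  next
    case (add w a g)
    then show ?case
      using A single [of "letters w" a]
      by (simp add: subalgebra_def hecke.subspace_add flip: plus_hecke.abs_eq)
  qed
  then show ?thesis
    using hecke.abs_induct [of "\<lambda>x. x \<in> A"] by auto
qed

text \<open>All three cyclic rotations of \<open>hs * ht * hu\<close> equal \<open>hz\<close>, and
  moving an outer letter of a product to the other end passes from one rotation to another.\<close>

lemma hz_central: "hz * hs = hs * hz" "hz * ht = ht * hz" "hz * hu = hu * hz"
proof -
  have "hz = ht * hu * hs" "hz = hu * hs * ht"
    by (simp_all add: hz_def hecke_braid)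
  then show "hz * hs = hs * hz" "hz * ht = ht * hz" "hz * hu = hu * hz"
    by (metis hz_def mult.assoc)+
qed

lemma hs_eq: "hs = hz * unit_inv hu * unit_inv ht"
proof -
  have "hz * unit_inv hu * unit_inv ht = hs * (ht * (hu * unit_inv hu) * unit_inv ht)"
    by (simp only: hz_def mult.assoc)
  then show ?thesis
    by (simp add: hecke_gen_unit_inv)
qed

section \<open>Integer powers of the generators\<close>

definition int_pow :: "'a::monoid_mult \<Rightarrow> int \<Rightarrow> 'a" where
  "int_pow x i = (if i \<ge> 0 then x ^ nat i else unit_inv x ^ nat (- i))"

lemma int_pow_simps [simp]:
  "int_pow x 0 = 1" "int_pow x 1 = x" "int_pow x (- 1) = unit_inv x"
  by (simp_all add: int_pow_def)

lemma int_pow_add: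
  assumes inv: "x * unit_inv x = 1" "unit_inv x * x = 1"
  shows "int_pow x (i + j) = int_pow x i * int_pow x j"
proof -
  have succ: "int_pow x (i + 1) = int_pow x i * x" for i
  proof (cases "i \<ge> 0")
    case True
    then show ?thesis
      by (simp add: int_pow_def nat_add_distrib power_commutes)
  next
    case False
    \<comment> \<open>A negative exponent is minus a successor, so one factor
      \<open>unit_inv x\<close> can be split off and cancelled against \<open>x\<close>.\<close>
    define n where "n = nat (- i - 1)"
    have i: "i = - int (Suc n)"
      using False by (simp add: n_def)
    have "int_pow x (i + 1) = unit_inv x ^ n"
      by (simp add: int_pow_def i)
    moreover have "int_pow x i = unit_inv x ^ n * unit_inv x"
      unfolding int_pow_def i by (simp add: power_commutes nat_add_distrib del: of_nat_Suc)
    ultimately show ?thesis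
      by (simp add: mult.assoc inv)
  qed
  have pred: "int_pow x (i - 1) = int_pow x i * unit_inv x" for i
    using succ [of "i - 1"] by (simp add: mult.assoc inv)
  show ?thesis
  proof (induction j rule: int_induct [where k = 0])
    case base
    show ?case by simp
  next
    case (step1 j)
    then show ?case
      using succ [of "i + j"] succ [of j] by (simp add: add.assoc mult.assoc)
  next
    case (step2 j)
    then show ?case
      using pred [of "i + j"] pred [of j] by (simp add: mult.assoc algebra_simps)
  qed
qed

lemmas pow_add = int_pow_add [OF hecke_gen_unit_inv(3,4)] int_pow_add [OF hecke_gen_unit_inv(5,6)]

lemma commute_unit_inv:
  fixes x y :: "'a::monoid_mult"
  assumes "x * unit_inv x = 1" "unit_inv x * x = 1" "y * x = x * y"
  shows "y * unit_inv x = unit_inv x * y"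
  by (metis assms mult.assoc mult_1_left mult_1_right)

lemma hz_pow_commute:
  "hz ^ k * int_pow ht i = int_pow ht i * hz ^ k"
  "hz ^ k * int_pow hu i = int_pow hu i * hz ^ k"
proof -
  have "hz * unit_inv ht = unit_inv ht * hz" "hz * unit_inv hu = unit_inv hu * hz"
    by (simp_all add: commute_unit_inv hecke_gen_unit_inv hz_central)
  then show "hz ^ k * int_pow ht i = int_pow ht i * hz ^ k"
    "hz ^ k * int_pow hu i = int_pow hu i * hz ^ k"
    unfolding int_pow_def by (auto intro!: power_commuting_commutes power_commuting_commutes [symmetric] simp: hz_central)
qed

section \<open>The defining polynomials as recurrences with unit outer coefficients\<close>

text \<open>Multiply the quadratic relation for \<open>hs\<close> on the right by
  \<open>ht * hu\<close>: the linear term becomes a multiple of \<open>hz\<close>, and the square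
  becomes \<open>hs * hz\<close>, in which \<open>hs\<close> is eliminated by \<open>hs_eq\<close>.
  The coefficient \<open>c0\<close> is minus the product of two parameters; \<open>d\<close> is its
  inverse.\<close>

lemma hecke_quadratic:
  obtains c1 c0 d where "hz * hz * unit_inv hu * unit_inv ht = c1 *\<^sub>H hz + c0 *\<^sub>H (ht * hu)" "d * c0 = 1"
proof
  let ?c1 = "indet us1 + indet us2" and ?c0 = "- indet us1 * indet us2"
  have "hs * hs = ?c1 *\<^sub>H hs + ?c0 *\<^sub>H 1"
    using hecke_poly(1) by (simp add: algebra_simps hecke_scale_mult)
  then have "hs * hs * (ht * hu) = (?c1 *\<^sub>H hs + ?c0 *\<^sub>H 1) * (ht * hu)"
    by simp
  moreover have "hs * hs * (ht * hu) = hs * hz"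
    by (simp add: hz_def mult.assoc)
  moreover have "hs * hz = hz * (hz * unit_inv hu * unit_inv ht)"
    using hs_eq hz_central(1) by metis
  ultimately show "hz * hz * unit_inv hu * unit_inv ht = ?c1 *\<^sub>H hz + ?c0 *\<^sub>H (ht * hu)"
    by (simp add: hz_def algebra_simps hecke_scale_mult)
  have "- indet_inv us1 * indet_inv us2 * ?c0 = (indet us1 * indet_inv us1) * (indet us2 * indet_inv us2)"
    by (simp only: minus_mult_minus ac_simps)
  then show "- indet_inv us1 * indet_inv us2 * ?c0 = 1"
    by simp
qed

text \<open>The coefficients are the signed elementary symmetric polynomials of the parameters.
  Multiplying the relation by \<open>int_pow ht i\<close> shifts it to every integer
  \<open>i\<close> with the same coefficients, so it can be run in both directions.\<close>

lemma hecke_cubic: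
  obtains c2 c1 c0 d where
    "\<And>i. int_pow ht (i + 3) = c2 *\<^sub>H int_pow ht (i + 2) + c1 *\<^sub>H int_pow ht (i + 1) + c0 *\<^sub>H int_pow ht i"
    "d * c0 = 1"
proof
  let ?c2 = "indet ut1 + indet ut2 + indet ut3"
    and ?c1 = "- (indet ut1 * indet ut2 + indet ut1 * indet ut3 + indet ut2 * indet ut3)"
    and ?c0 = "indet ut1 * indet ut2 * indet ut3"
  have "ht * ht * ht = ?c2 *\<^sub>H (ht * ht) + ?c1 *\<^sub>H ht + ?c0 *\<^sub>H 1"
    using hecke_poly(2) by (simp add: algebra_simps hecke_scale_mult)
  then show "int_pow ht (i + 3) = ?c2 *\<^sub>H int_pow ht (i + 2) + ?c1 *\<^sub>H int_pow ht (i + 1) + ?c0 *\<^sub>H int_pow ht i" for i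
    using arg_cong [where f = "\<lambda>x. int_pow ht i * x"]
    by (simp add: pow_add int_pow_def [of _ 3] int_pow_def [of _ 2] eval_nat_numeral
        distrib_left right_diff_distrib hecke_scale_mult mult.assoc)
  have "indet_inv ut1 * indet_inv ut2 * indet_inv ut3 * ?c0
      = (indet ut1 * indet_inv ut1) * (indet ut2 * indet_inv ut2) * (indet ut3 * indet_inv ut3)"
    by (simp only: ac_simps)
  then show "indet_inv ut1 * indet_inv ut2 * indet_inv ut3 * ?c0 = 1"
    by simp
qed

lemma hecke_quartic:
  obtains c3 c2 c1 c0 d where
    "\<And>i. int_pow hu (i + 4) = c3 *\<^sub>H int_pow hu (i + 3) + c2 *\<^sub>H int_pow hu (i + 2)
        + c1 *\<^sub>H int_pow hu (i + 1) + c0 *\<^sub>H int_pow hu i"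
    "d * c0 = 1"
proof
  let ?p = "indet uu1" and ?q = "indet uu2" and ?r = "indet uu3" and ?v = "indet uu4"
  let ?c3 = "?p + ?q + ?r + ?v"
    and ?c2 = "- (?p * ?q + ?p * ?r + ?p * ?v + ?q * ?r + ?q * ?v + ?r * ?v)"
    and ?c1 = "?p * ?q * ?r + ?p * ?q * ?v + ?p * ?r * ?v + ?q * ?r * ?v"
    and ?c0 = "- (?p * ?q * ?r * ?v)"
  have "hu * hu * hu * hu = ?c3 *\<^sub>H (hu * hu * hu) + ?c2 *\<^sub>H (hu * hu) + ?c1 *\<^sub>H hu + ?c0 *\<^sub>H 1"
    using hecke_poly(3) by (simp add: algebra_simps hecke_scale_mult)
  then show "int_pow hu (i + 4) = ?c3 *\<^sub>H int_pow hu (i + 3) + ?c2 *\<^sub>H int_pow hu (i + 2)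
        + ?c1 *\<^sub>H int_pow hu (i + 1) + ?c0 *\<^sub>H int_pow hu i" for i
    using arg_cong [where f = "\<lambda>x. int_pow hu i * x"]
    by (simp add: pow_add int_pow_def [of _ 4] int_pow_def [of _ 3] int_pow_def [of _ 2] eval_nat_numeral
        distrib_left right_diff_distrib hecke_scale_mult mult.assoc)
  \<comment> \<open>The degree is even, so \<open>?c0\<close> is minus the product of the
    parameters; its inverse carries the same sign.\<close>
  let ?e = "- (indet_inv uu1 * indet_inv uu2 * indet_inv uu3 * indet_inv uu4)"
  have "indet_inv uu1 * indet_inv uu2 * indet_inv uu3 * indet_inv uu4 * (?p * ?q * ?r * ?v)
      = (?p * indet_inv uu1) * (?q * indet_inv uu2) * (?r * indet_inv uu3) * (?v * indet_inv uu4)"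
    by (simp only: ac_simps)
  also have "\<dots> = 1"
    by simp
  finally show "?e * ?c0 = 1"
    by simp
qed

text \<open>Solving for \<open>r\<close> gives \<open>d *\<^sub>H (p - q)\<close>; this is how a
  relation is read backwards.\<close>

lemma unit_combination:
  assumes "d * c0 = 1" "p = q + c0 *\<^sub>H r" "hecke.subspace S" "p \<in> S" "q \<in> S"
  shows "r \<in> S"
proof -
  have "r = d *\<^sub>H (p - q)"
    using assms(1,2) by simp
  then show ?thesis
    using assms(3-5) by (metis hecke.subspace_diff hecke.subspace_scale)
qed

section \<open>Submodules are closed under solving a relation for an outer term\<close>

text \<open>The preimage of \<open>S\<close> under multiplication by \<open>x\<close> on the left
  and \<open>y\<close> on the right. Through it a relation applies in the middle of a longer
  product.\<close>

definition sandwich :: "hecke \<Rightarrow> hecke \<Rightarrow> hecke set \<Rightarrow> hecke set" where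
  "sandwich x y S = {h. x * h * y \<in> S}"

lemma subspace_sandwich: "hecke.subspace S \<Longrightarrow> hecke.subspace (sandwich x y S)"
  by (auto simp: sandwich_def hecke.subspace_def distrib_left distrib_right hecke_scale_mult)

lemma cubic_closure:
  assumes S: "hecke.subspace S"
  shows "int_pow ht (i + 2) \<in> S \<Longrightarrow> int_pow ht (i + 1) \<in> S \<Longrightarrow> int_pow ht i \<in> S \<Longrightarrow> int_pow ht (i + 3) \<in> S"
    "int_pow ht (i + 3) \<in> S \<Longrightarrow> int_pow ht (i + 2) \<in> S \<Longrightarrow> int_pow ht (i + 1) \<in> S \<Longrightarrow> int_pow ht i \<in> S"
proof -
  obtain c2 c1 c0 d where c: "int_pow ht (i + 3)
      = c2 *\<^sub>H int_pow ht (i + 2) + c1 *\<^sub>H int_pow ht (i + 1) + c0 *\<^sub>H int_pow ht i" "d * c0 = 1"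
    using hecke_cubic by metis
  show "int_pow ht (i + 2) \<in> S \<Longrightarrow> int_pow ht (i + 1) \<in> S \<Longrightarrow> int_pow ht i \<in> S \<Longrightarrow> int_pow ht (i + 3) \<in> S"
    using S c(1) by (simp add: hecke.subspace_add hecke.subspace_scale)
  show "int_pow ht (i + 3) \<in> S \<Longrightarrow> int_pow ht (i + 2) \<in> S \<Longrightarrow> int_pow ht (i + 1) \<in> S \<Longrightarrow> int_pow ht i \<in> S"
    by (rule unit_combination [OF c(2,1) S]) (simp_all add: S hecke.subspace_add hecke.subspace_scale)
qed

lemma quartic_closure:
  assumes S: "hecke.subspace S"
  shows "int_pow hu (i + 3) \<in> S \<Longrightarrow> int_pow hu (i + 2) \<in> S \<Longrightarrow> int_pow hu (i + 1) \<in> S \<Longrightarrow> int_pow hu i \<in> S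
      \<Longrightarrow> int_pow hu (i + 4) \<in> S"
    "int_pow hu (i + 4) \<in> S \<Longrightarrow> int_pow hu (i + 3) \<in> S \<Longrightarrow> int_pow hu (i + 2) \<in> S \<Longrightarrow> int_pow hu (i + 1) \<in> S
      \<Longrightarrow> int_pow hu i \<in> S"
proof -
  obtain c3 c2 c1 c0 d where c: "int_pow hu (i + 4) = c3 *\<^sub>H int_pow hu (i + 3)
      + c2 *\<^sub>H int_pow hu (i + 2) + c1 *\<^sub>H int_pow hu (i + 1) + c0 *\<^sub>H int_pow hu i" "d * c0 = 1"
    using hecke_quartic by metis
  show "int_pow hu (i + 3) \<in> S \<Longrightarrow> int_pow hu (i + 2) \<in> S \<Longrightarrow> int_pow hu (i + 1) \<in> S \<Longrightarrow> int_pow hu i \<in> S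
      \<Longrightarrow> int_pow hu (i + 4) \<in> S"
    using S c(1) by (simp add: hecke.subspace_add hecke.subspace_scale)
  show "int_pow hu (i + 4) \<in> S \<Longrightarrow> int_pow hu (i + 3) \<in> S \<Longrightarrow> int_pow hu (i + 2) \<in> S \<Longrightarrow> int_pow hu (i + 1) \<in> S
      \<Longrightarrow> int_pow hu i \<in> S"
    by (rule unit_combination [OF c(2,1) S]) (simp_all add: S hecke.subspace_add hecke.subspace_scale)
qed

text \<open>There is a rule for each of the two terms with unit coefficient; the coefficient of
  \<open>hz\<close> is a sum of two parameters and cannot be inverted.\<close>

lemma quadratic_closure:
  assumes S: "hecke.subspace S"
  shows "hz * hz * unit_inv hu * unit_inv ht \<in> S \<Longrightarrow> hz \<in> S \<Longrightarrow> ht * hu \<in> S"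
    "hz \<in> S \<Longrightarrow> ht * hu \<in> S \<Longrightarrow> hz * hz * unit_inv hu * unit_inv ht \<in> S"
proof -
  obtain c1 c0 d where c: "hz * hz * unit_inv hu * unit_inv ht = c1 *\<^sub>H hz + c0 *\<^sub>H (ht * hu)" "d * c0 = 1"
    by (rule hecke_quadratic)
  show "hz * hz * unit_inv hu * unit_inv ht \<in> S \<Longrightarrow> hz \<in> S \<Longrightarrow> ht * hu \<in> S"
    by (rule unit_combination [OF c(2,1) S]) (simp_all add: S hecke.subspace_scale)
  show "hz \<in> S \<Longrightarrow> ht * hu \<in> S \<Longrightarrow> hz * hz * unit_inv hu * unit_inv ht \<in> S"
    using S c(1) by (simp add: hecke.subspace_add hecke.subspace_scale)
qed

text \<open>Three consecutive powers of \<open>ht\<close>, or four of \<open>hu\<close>, determine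
  the neighbouring power on either side, so one such window slides over all integers.\<close>

lemma int_pow_mem:
  assumes S: "hecke.subspace S"
  shows "1 \<in> S \<Longrightarrow> ht \<in> S \<Longrightarrow> unit_inv ht \<in> S \<Longrightarrow> int_pow ht i \<in> S"
    and "1 \<in> S \<Longrightarrow> hu \<in> S \<Longrightarrow> unit_inv hu \<in> S \<Longrightarrow> int_pow hu 2 \<in> S \<Longrightarrow> int_pow hu i \<in> S"
proof -
  show "int_pow ht i \<in> S" if "1 \<in> S" "ht \<in> S" "unit_inv ht \<in> S"
  proof -
    \<comment> \<open>The induction carries the whole window; the offsets \<open>i - 1\<close> and
      \<open>i - 2\<close> below align the recurrence with its lower end before and after the
      shift.\<close>
    have "int_pow ht (i - 1) \<in> S \<and> int_pow ht i \<in> S \<and> int_pow ht (i + 1) \<in> S"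
    proof (induction i rule: int_induct [where k = 0])
      case (step1 i)
      then show ?case
        using cubic_closure(1) [OF S, of "i - 1"] by (simp add: algebra_simps)
    next
      case (step2 i)
      then show ?case
        using cubic_closure(2) [OF S, of "i - 2"] by (simp add: algebra_simps)
    qed (simp add: that)
    then show ?thesis by simp
  qed
  show "int_pow hu i \<in> S" if "1 \<in> S" "hu \<in> S" "unit_inv hu \<in> S" "int_pow hu 2 \<in> S"
  proof -
    have "int_pow hu (i - 1) \<in> S \<and> int_pow hu i \<in> S \<and> int_pow hu (i + 1) \<in> S \<and> int_pow hu (i + 2) \<in> S"
    proof (induction i rule: int_induct [where k = 0])
      case (step1 i)
      then show ?case
        using quartic_closure(1) [OF S, of "i - 1"] by (simp add: algebra_simps)
    next
      case (step2 i)
      then show ?case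
        using quartic_closure(2) [OF S, of "i - 2"] by (simp add: algebra_simps)
    qed (simp add: that)
    then show ?thesis by simp
  qed
qed

section \<open>The module U\<close>

lemma subspace_span_prod: "hecke.subspace (X \<odot> Y)"
  by (simp add: span_prod_def)

lemma span_prod_mem: "x \<in> X \<Longrightarrow> y \<in> Y \<Longrightarrow> x * y \<in> X \<odot> Y"
  by (auto simp: span_prod_def intro!: hecke.span_base)

lemma span_prod_subset:
  assumes "hecke.subspace S" "\<And>x y. x \<in> X \<Longrightarrow> y \<in> Y \<Longrightarrow> x * y \<in> S"
  shows "X \<odot> Y \<subseteq> S"
  unfolding span_prod_def using assms by (intro hecke.span_minimal) auto

lemma subspace_right_mult: "hecke.subspace S \<Longrightarrow> hecke.subspace {x. x * y \<in> S}"
  by (auto simp: hecke.subspace_def distrib_right hecke_scale_mult)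

lemma subspace_left_mult: "hecke.subspace S \<Longrightarrow> hecke.subspace {x. y * x \<in> S}"
  by (auto simp: hecke.subspace_def distrib_left hecke_scale_mult)

lemma span_prod3_subset:
  assumes S: "hecke.subspace S" and mem: "\<And>x y w. x \<in> X \<Longrightarrow> y \<in> Y \<Longrightarrow> w \<in> W \<Longrightarrow> x * y * w \<in> S"
  shows "X \<odot> Y \<odot> W \<subseteq> S"
proof (rule span_prod_subset [OF S])
  fix x w assume "x \<in> X \<odot> Y" "w \<in> W"
  then show "x * w \<in> S"
    using span_prod_subset [OF subspace_right_mult [OF S], of X Y w] mem by auto
qed

lemma subspace_set_plus:
  assumes A: "hecke.subspace A" and B: "hecke.subspace B"
  shows "hecke.subspace (A + B)"
proof (rule hecke.subspaceI)
  show "0 \<in> A + B"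
    using set_plus_intro [OF A [THEN hecke.subspace_0] B [THEN hecke.subspace_0]] by simp
next
  fix x y assume "x \<in> A + B" "y \<in> A + B"
  then obtain a b c d where "x = a + b" "y = c + d" "a \<in> A" "b \<in> B" "c \<in> A" "d \<in> B"
    by (auto elim!: set_plus_elim)
  moreover from this have "x + y = (a + c) + (b + d)"
    by (simp add: ac_simps)
  ultimately show "x + y \<in> A + B"
    using set_plus_intro [of "a + c" A "b + d" B] A B by (metis hecke.subspace_add)
next
  fix c x assume "x \<in> A + B"
  then obtain a b where "x = a + b" "a \<in> A" "b \<in> B"
    by (auto elim!: set_plus_elim)
  then show "c *\<^sub>H x \<in> A + B"
    using set_plus_intro [of "c *\<^sub>H a" A "c *\<^sub>H b" B] A B
    by (simp add: hecke.scale_right_distrib hecke.subspace_scale)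
qed

text \<open>The elementwise sum is the least submodule containing all summands. The claims are
  proved jointly because including one summand in the sum needs 0 in the rest, hence that the
  partial sum is a submodule.\<close>

lemma sum_of_submodules:
  fixes f :: "nat \<Rightarrow> hecke set"
  assumes "finite I" "\<And>k. k \<in> I \<Longrightarrow> hecke.subspace (f k)"
  shows "hecke.subspace (\<Sum>k\<in>I. f k)"
    and "\<And>k. k \<in> I \<Longrightarrow> f k \<subseteq> (\<Sum>k\<in>I. f k)"
    and "\<And>S. hecke.subspace S \<Longrightarrow> (\<And>k. k \<in> I \<Longrightarrow> f k \<subseteq> S) \<Longrightarrow> (\<Sum>k\<in>I. f k) \<subseteq> S"
proof -
  have "hecke.subspace (\<Sum>k\<in>I. f k) \<and> (\<forall>k\<in>I. f k \<subseteq> (\<Sum>k\<in>I. f k)) \<and>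
      (\<forall>S. hecke.subspace S \<longrightarrow> (\<forall>k\<in>I. f k \<subseteq> S) \<longrightarrow> (\<Sum>k\<in>I. f k) \<subseteq> S)"
    using assms
  proof (induction I rule: finite_induct)
    case empty
    then show ?case by (auto simp: set_zero hecke.subspace_0)
  next
    case (insert k I)
    let ?A = "f k" and ?B = "\<Sum>k\<in>I. f k"
    have AB: "hecke.subspace ?A" "hecke.subspace ?B"
      using insert by auto
    have "hecke.subspace (?A + ?B)"
      by (rule subspace_set_plus [OF AB])
    moreover have "?A \<subseteq> ?A + ?B" "?B \<subseteq> ?A + ?B"
      using set_zero_plus2 hecke.subspace_0 AB by (metis add.commute)+
    moreover have "?A + ?B \<subseteq> S" if "hecke.subspace S" "?A \<subseteq> S" "?B \<subseteq> S" for S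
      using that by (auto simp: set_plus_def intro: hecke.subspace_add)
    moreover have "\<forall>i\<in>I. f i \<subseteq> ?B" "\<forall>S. hecke.subspace S \<longrightarrow> (\<forall>i\<in>I. f i \<subseteq> S) \<longrightarrow> ?B \<subseteq> S"
      using insert by auto
    ultimately show ?case
      unfolding sum.insert [OF insert.hyps] by (blast intro: subset_trans)
  qed
  then show "hecke.subspace (\<Sum>k\<in>I. f k)"
    and "\<And>k. k \<in> I \<Longrightarrow> f k \<subseteq> (\<Sum>k\<in>I. f k)"
    and "\<And>S. hecke.subspace S \<Longrightarrow> (\<And>k. k \<in> I \<Longrightarrow> f k \<subseteq> S) \<Longrightarrow> (\<Sum>k\<in>I. f k) \<subseteq> S"
    by blast+
qed

lemma subalgebra_alg: "subalgebra alg_u2" "subalgebra alg_u3"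
proof -
  have "subalgebra (subalgebra hull X)" for X
  proof (rule hull_in)
    show "subalgebra (\<Inter>T)" if "Ball T subalgebra" for T
      using that hecke.subspace_Inter [of T] by (simp add: subalgebra_def)
  qed
  then show "subalgebra alg_u2" "subalgebra alg_u3"
    by (simp_all add: alg_u2_def alg_u3_def)
qed

lemma gen_mem_alg: "ht \<in> alg_u2" "hu \<in> alg_u3"
  unfolding alg_u2_def alg_u3_def using hull_subset [of _ subalgebra] by auto


definition mod_U_layer :: "nat \<Rightarrow> hecke set" where
  "mod_U_layer k = {hz ^ k} \<odot> alg_u3 \<odot> alg_u2 + {hz ^ k} \<odot> alg_u3 \<odot> {ht * unit_inv hu} \<odot> alg_u2"

lemma mod_U_eq: "mod_U = (\<Sum>k\<in>{0..23}. mod_U_layer k)"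
  by (simp add: mod_U_def mod_U_layer_def)

lemma subspace_mod_U_layer: "hecke.subspace (mod_U_layer k)"
  unfolding mod_U_layer_def by (intro subspace_set_plus subspace_span_prod)

lemma subspace_mod_U: "hecke.subspace mod_U"
  unfolding mod_U_eq by (intro sum_of_submodules(1) subspace_mod_U_layer) simp

lemma mod_U_base:
  assumes "k \<le> 23" "a \<in> alg_u3" "b \<in> alg_u2"
  shows "hz ^ k * a * b \<in> mod_U" "hz ^ k * a * (ht * unit_inv hu) * b \<in> mod_U"
proof -
  let ?A = "{hz ^ k} \<odot> alg_u3 \<odot> alg_u2" and ?B = "{hz ^ k} \<odot> alg_u3 \<odot> {ht * unit_inv hu} \<odot> alg_u2"
  have "hz ^ k * a * b \<in> ?A" "hz ^ k * a * (ht * unit_inv hu) * b \<in> ?B"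
    using assms by (simp_all add: span_prod_mem)
  moreover have "?A \<subseteq> mod_U_layer k" "?B \<subseteq> mod_U_layer k"
    using set_zero_plus2 hecke.subspace_0 subspace_span_prod unfolding mod_U_layer_def
    by (metis add.commute)+
  moreover have "mod_U_layer k \<subseteq> mod_U"
    unfolding mod_U_eq by (intro sum_of_submodules(2) subspace_mod_U_layer) (simp_all add: assms)
  ultimately show "hz ^ k * a * b \<in> mod_U" "hz ^ k * a * (ht * unit_inv hu) * b \<in> mod_U"
    by blast+
qed

text \<open>An induction principle for U. It is applied to preimages of U under one-sided
  multiplications, so stability has to be checked on products only.\<close>

lemma mod_U_subset:
  assumes S: "hecke.subspace S"
    and mem: "\<And>k a b. k \<le> 23 \<Longrightarrow> a \<in> alg_u3 \<Longrightarrow> b \<in> alg_u2 \<Longrightarrow> hz ^ k * a * b \<in> S"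
      "\<And>k a b. k \<le> 23 \<Longrightarrow> a \<in> alg_u3 \<Longrightarrow> b \<in> alg_u2 \<Longrightarrow> hz ^ k * a * (ht * unit_inv hu) * b \<in> S"
  shows "mod_U \<subseteq> S"
  unfolding mod_U_eq
proof (rule sum_of_submodules(3) [OF _ subspace_mod_U_layer S])
  fix k :: nat assume k: "k \<in> {0..23}"
  have "{hz ^ k} \<odot> alg_u3 \<odot> alg_u2 \<subseteq> S"
    by (rule span_prod3_subset [OF S]) (use mem(1) k in auto)
  moreover have "{hz ^ k} \<odot> alg_u3 \<odot> {ht * unit_inv hu} \<odot> alg_u2 \<subseteq> S"
  proof (rule span_prod_subset [OF S])
    fix x b assume x: "x \<in> {hz ^ k} \<odot> alg_u3 \<odot> {ht * unit_inv hu}" and b: "b \<in> alg_u2"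
    have "{hz ^ k} \<odot> alg_u3 \<odot> {ht * unit_inv hu} \<subseteq> {x. x * b \<in> S}"
      by (rule span_prod3_subset [OF subspace_right_mult [OF S]]) (use mem(2) k b in auto)
    with x show "x * b \<in> S" by blast
  qed
  ultimately show "mod_U_layer k \<subseteq> S"
    unfolding mod_U_layer_def using S by (auto elim!: set_plus_elim intro: hecke.subspace_add)
qed simp

section \<open>Stability under u on the left and t on the right\<close>

definition left_stabilizer :: "hecke set \<Rightarrow> hecke set" where
  "left_stabilizer S = {a. \<forall>x\<in>S. a * x \<in> S}"

lemma subalgebra_left_stabilizer: "hecke.subspace S \<Longrightarrow> subalgebra (left_stabilizer S)"
  by (auto simp: subalgebra_def left_stabilizer_def hecke.subspace_def distrib_right
      hecke_scale_mult mult.assoc)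

text \<open>The subalgebras are generated by \<open>ht\<close> and \<open>hu\<close> alone. Their
  inverses come from reading the recurrences backwards from the exponents 0 to 2, respectively 0 to
  3, down to -1.\<close>

lemma int_pow_mem_alg: "int_pow ht i \<in> alg_u2" "int_pow hu i \<in> alg_u3"
proof -
  have mem: "x \<in> A \<Longrightarrow> y \<in> A \<Longrightarrow> x * y \<in> A" "1 \<in> A" if "subalgebra A" for A x y
    using that by (auto simp: subalgebra_def)
  have sub: "hecke.subspace alg_u2" "hecke.subspace alg_u3"
    using subalgebra_alg by (auto simp: subalgebra_def)
  have t: "int_pow ht 2 \<in> alg_u2" "int_pow ht 1 \<in> alg_u2" "int_pow ht 0 \<in> alg_u2"
    using mem [OF subalgebra_alg(1)] gen_mem_alg by (simp_all add: int_pow_def power2_eq_square)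
  moreover have "unit_inv ht \<in> alg_u2"
    using cubic_closure(2) [OF sub(1), of "-1"] t by simp
  ultimately show "int_pow ht i \<in> alg_u2"
    using int_pow_mem(1) [OF sub(1)] by simp
  have u: "int_pow hu 3 \<in> alg_u3" "int_pow hu 2 \<in> alg_u3" "int_pow hu 1 \<in> alg_u3" "int_pow hu 0 \<in> alg_u3"
    using mem [OF subalgebra_alg(2)] gen_mem_alg
    by (simp_all add: int_pow_def power2_eq_square power3_eq_cube)
  moreover have "unit_inv hu \<in> alg_u3"
    using quartic_closure(2) [OF sub(2), of "-1"] u by simp
  ultimately show "int_pow hu i \<in> alg_u3"
    using int_pow_mem(2) [OF sub(2)] by simp
qed

text \<open>A left factor from \<open>alg_u3\<close> passes the central power of \<open>hz\<close>
  and is absorbed by the factor from \<open>alg_u3\<close> in each summand.\<close>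

lemma alg_u3_left_stabilizes: "alg_u3 \<subseteq> left_stabilizer mod_U"
proof -
  have "mod_U \<subseteq> {x. a * x \<in> mod_U}" if a: "a \<in> alg_u3" for a
  proof (rule mod_U_subset)
    show "hecke.subspace {x. a * x \<in> mod_U}"
      by (rule subspace_left_mult [OF subspace_mod_U])
  next
    fix k c b assume *: "k \<le> (23::nat)" "c \<in> alg_u3" "b \<in> alg_u2"
    have "a * hz ^ k = hz ^ k * a"
    proof -
      \<comment> \<open>The centralizer of \<open>hz ^ k\<close> is a subalgebra, so only the
        generator \<open>hu\<close> has to be tested.\<close>
      have "alg_u3 \<subseteq> {a. a * hz ^ k = hz ^ k * a}"
        unfolding alg_u3_def
      proof (rule subalgebra_hull_subset)
        show "x * y \<in> {a. a * hz ^ k = hz ^ k * a}"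
          if "x \<in> {a. a * hz ^ k = hz ^ k * a}" "y \<in> {a. a * hz ^ k = hz ^ k * a}" for x y
          using that by (metis (mono_tags) mem_Collect_eq mult.assoc)
        show "hu \<in> {a. a * hz ^ k = hz ^ k * a}"
          using hz_pow_commute(2) [of k 1] by simp
      qed (auto simp: hecke.subspace_def distrib_left distrib_right hecke_scale_mult)
      with a show ?thesis by blast
    qed
    moreover have "a * c \<in> alg_u3"
      using subalgebra_alg(2) a * by (simp add: subalgebra_def)
    ultimately show "hz ^ k * c * b \<in> {x. a * x \<in> mod_U}"
        "hz ^ k * c * (ht * unit_inv hu) * b \<in> {x. a * x \<in> mod_U}"
      using mod_U_base [OF *(1) \<open>a * c \<in> alg_u3\<close> *(3)] by (simp_all flip: mult.assoc)
  qed
  then show ?thesis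
    by (auto simp: left_stabilizer_def)
qed

lemma mod_U_right_mult:
  assumes "x \<in> mod_U" "b \<in> alg_u2"
  shows "x * b \<in> mod_U"
proof -
  have "mod_U \<subseteq> {x. x * b \<in> mod_U}"
  proof (rule mod_U_subset)
    show "hecke.subspace {x. x * b \<in> mod_U}"
      by (rule subspace_right_mult [OF subspace_mod_U])
  next
    fix k a c assume *: "k \<le> (23::nat)" "a \<in> alg_u3" "c \<in> alg_u2"
    have "c * b \<in> alg_u2"
      using subalgebra_alg(1) assms * by (simp add: subalgebra_def)
    from mod_U_base [OF *(1,2) this]
    show "hz ^ k * a * c \<in> {x. x * b \<in> mod_U}" "hz ^ k * a * (ht * unit_inv hu) * c \<in> {x. x * b \<in> mod_U}"
      by (simp_all add: mult.assoc)
  qed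
  with assms show ?thesis by blast
qed

text \<open>The inverse of a power of u is again a power of u, so stability yields both directions.
  Outer powers may therefore be deleted or inserted freely.\<close>

lemma mod_U_left_pow_iff: "int_pow hu i * x \<in> mod_U \<longleftrightarrow> x \<in> mod_U"
proof -
  have "int_pow hu j * y \<in> mod_U" if "y \<in> mod_U" for j y
    using that alg_u3_left_stabilizes int_pow_mem_alg(2) by (auto simp: left_stabilizer_def)
  moreover have "int_pow hu (- i) * (int_pow hu i * x) = x"
    by (simp flip: mult.assoc pow_add)
  ultimately show ?thesis by metis
qed

lemma mod_U_right_pow_iff: "x * int_pow ht i \<in> mod_U \<longleftrightarrow> x \<in> mod_U"
proof -
  have "(x * int_pow ht i) * int_pow ht (- i) = x"
    by (simp add: mult.assoc flip: pow_add)
  then show ?thesis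
    using mod_U_right_mult int_pow_mem_alg(1) by metis
qed

section \<open>Words\<close>

text \<open>A list of exponents stands for a product of alternating powers of t and u; the flag tells
  whether it starts with t. Zero exponents are allowed, so every word in t and u is covered.\<close>

fun word_val :: "bool \<Rightarrow> int list \<Rightarrow> hecke" where
  "word_val b [] = 1"
| "word_val b (i # w) = int_pow (if b then ht else hu) i * word_val (\<not> b) w"

lemma word_val_append:
  "word_val b (v @ w) = word_val b v * word_val (if even (length v) then b else \<not> b) w"
  by (induction v arbitrary: b) (auto simp: mult.assoc)

section \<open>Normal forms of words\<close>

text \<open>The neighbours of a zero exponent are powers of the same generator and merge. If the
  merged exponent vanishes in turn, the next \<open>push\<close> removes it, so a single pass from
  the right leaves a zero at most at the head.\<close>

definition push :: "int \<Rightarrow> int list \<Rightarrow> int list" where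
  "push a w = (if w \<noteq> [] \<and> hd w = 0
    then if tl w = [] then [a] else (a + hd (tl w)) # tl (tl w) else a # w)"

fun free_reduce :: "int list \<Rightarrow> int list" where
  "free_reduce [] = []"
| "free_reduce (a # w) = push a (free_reduce w)"

lemma word_val_push: "word_val b (push a w) = word_val b (a # w)"
proof (cases w)
  case (Cons c v)
  show ?thesis
    by (cases v; simp add: Cons push_def pow_add mult.assoc)
qed (simp add: push_def)

lemma word_val_free_reduce: "word_val b (free_reduce w) = word_val b w"
  by (induction w arbitrary: b) (simp_all add: word_val_push)

text \<open>The module U is stable under left multiplication by powers of u and right multiplication by
  powers of t, so such powers at the ends of a word are irrelevant.\<close>

definition strip :: "int list \<Rightarrow> int list" where
  "strip w = (let v = (if w \<noteq> [] \<and> hd w = 0 then drop 2 w else w) in if odd (length v) then butlast v else v)"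

definition norm_word :: "int list \<Rightarrow> int list" where
  "norm_word w = strip (free_reduce w)"

text \<open>Words are always read as starting with t; one that starts with u gets a leading exponent
  0.\<close>

definition in_U :: "nat \<Rightarrow> int list \<Rightarrow> bool" where
  "in_U k w \<longleftrightarrow> hz ^ k * word_val True w \<in> mod_U"

lemma in_U_drop_left: "in_U k (0 # i # w) = in_U k w"
proof -
  have "hz ^ k * word_val True (0 # i # w) = int_pow hu i * (hz ^ k * word_val True w)"
    using hz_pow_commute(2) [of k i] by (simp flip: mult.assoc)
  then show ?thesis
    by (simp add: in_U_def mod_U_left_pow_iff)
qed

text \<open>At odd length the last syllable is a power of t, which right stability discards.\<close>

lemma in_U_drop_right:
  assumes "odd (length w)"
  shows "in_U k (butlast w) = in_U k w"
proof -
  have "w = butlast w @ [last w]"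
    using assms by (cases w rule: rev_cases) auto
  moreover have "even (length (butlast w))"
    using assms by simp
  ultimately have "word_val True w = word_val True (butlast w) * int_pow ht (last w)"
    using word_val_append [of True "butlast w" "[last w]"] by simp
  then show ?thesis
    by (simp add: in_U_def mod_U_right_pow_iff flip: mult.assoc)
qed

text \<open>Words with a common normal form are interchangeable, so the rules below can match their
  words by evaluating \<open>norm_word\<close>.\<close>

lemma in_U_norm: "in_U k (norm_word w) = in_U k w"
proof -
  have "in_U k (if v \<noteq> [] \<and> hd v = 0 then drop 2 v else v) = in_U k v" for v
  proof (cases v)
    case (Cons a v')
    then show ?thesis
      by (cases v') (auto simp: in_U_drop_left [unfolded in_U_def, simplified] in_U_def)
  qed simp
  then have "in_U k (strip v) = in_U k v" for v
    by (simp add: strip_def Let_def in_U_drop_right)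
  then show ?thesis
    by (simp add: norm_word_def in_U_def word_val_free_reduce)
qed

lemma hz_commute_word_val: "hz ^ k * word_val b w = word_val b w * hz ^ k"
proof (induction w arbitrary: b)
  case (Cons i w)
  have "hz ^ k * word_val b (i # w) = int_pow (if b then ht else hu) i * (hz ^ k * word_val (\<not> b) w)"
    using hz_pow_commute [of k i] by (simp flip: mult.assoc)
  then show ?case
    by (simp add: Cons.IH mult.assoc)
qed simp

section \<open>The relations as rules on words\<close>

text \<open>Isolates one exponent. The parity of its position decides whether it belongs to t or to
  u, hence whether the cubic or the quartic recurrence applies.\<close>

lemma in_U_single:
  "in_U k (x @ c # y) \<longleftrightarrow>
    int_pow (if even (length x) then ht else hu) c
      \<in> sandwich (hz ^ k * word_val True x) (word_val (odd (length x)) y) mod_U"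
  by (simp add: in_U_def sandwich_def word_val_append mult.assoc)

lemma in_U_cubic:
  assumes "even (length x)"
  shows "in_U k (x @ (a + 2) # y) \<Longrightarrow> in_U k (x @ (a + 1) # y) \<Longrightarrow> in_U k (x @ a # y)
      \<Longrightarrow> in_U k (x @ (a + 3) # y)"
    and "in_U k (x @ (a + 3) # y) \<Longrightarrow> in_U k (x @ (a + 2) # y) \<Longrightarrow> in_U k (x @ (a + 1) # y)
      \<Longrightarrow> in_U k (x @ a # y)"
  unfolding in_U_single using assms
  by (auto intro: cubic_closure subspace_sandwich subspace_mod_U)

lemma in_U_quartic:
  assumes "odd (length x)"
  shows "in_U k (x @ (a + 3) # y) \<Longrightarrow> in_U k (x @ (a + 2) # y) \<Longrightarrow> in_U k (x @ (a + 1) # y)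
      \<Longrightarrow> in_U k (x @ a # y) \<Longrightarrow> in_U k (x @ (a + 4) # y)"
    and "in_U k (x @ (a + 4) # y) \<Longrightarrow> in_U k (x @ (a + 3) # y) \<Longrightarrow> in_U k (x @ (a + 2) # y)
      \<Longrightarrow> in_U k (x @ (a + 1) # y) \<Longrightarrow> in_U k (x @ a # y)"
  unfolding in_U_single using assms
  by (auto intro: quartic_closure subspace_sandwich subspace_mod_U)

text \<open>The relation is inserted between \<open>int_pow ht a\<close> and
  \<open>int_pow hu b\<close>. Its terms \<open>ht * hu\<close>, \<open>hz\<close> and the one with
  \<open>hz * hz\<close> give the three words, with exponents of z equal to \<open>k\<close>,
  \<open>k + 1\<close> and \<open>k + 2\<close>.\<close>

lemma in_U_quadratic:
  assumes "even (length x)"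
  shows "in_U (k + 1) (x @ a # b # y) \<Longrightarrow> in_U (k + 2) (x @ a # - 1 # - 1 # b # y)
      \<Longrightarrow> in_U k (x @ (a + 1) # (b + 1) # y)"
    and "in_U k (x @ (a + 1) # (b + 1) # y) \<Longrightarrow> in_U (k + 1) (x @ a # b # y)
      \<Longrightarrow> in_U (k + 2) (x @ a # - 1 # - 1 # b # y)"
proof -
  define p where "p = word_val True x * int_pow ht a"
  define q where "q = int_pow hu b * word_val True y"
  let ?S = "sandwich (hz ^ k * p) q mod_U"
  have S: "hecke.subspace ?S"
    by (intro subspace_sandwich subspace_mod_U)
  \<comment> \<open>The relation puts powers of \<open>hz\<close> inside the word, whereas
    \<open>in_U\<close> expects them in front.\<close>
  have comm: "p * hz ^ n = hz ^ n * p" for n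
    using hz_commute_word_val [of n True x] hz_pow_commute(1) [of n a]
    unfolding p_def by (metis mult.assoc)
  have "in_U k (x @ (a + 1) # (b + 1) # y) \<longleftrightarrow> ht * hu \<in> ?S"
    using assms by (simp add: in_U_def sandwich_def word_val_append p_def q_def pow_add add.commute [of b 1] mult.assoc)
  moreover have "in_U (k + 1) (x @ a # b # y) \<longleftrightarrow> hz \<in> ?S"
  proof -
    have "hz ^ (k + 1) * word_val True (x @ a # b # y) = hz ^ k * (hz ^ 1 * p) * q"
      using assms by (simp add: word_val_append p_def q_def mult.assoc power_Suc2 del: power_Suc)
    also have "\<dots> = hz ^ k * (p * hz ^ 1) * q"
      by (simp only: comm)
    also have "\<dots> = hz ^ k * p * hz * q"
      by (simp add: mult.assoc)
    finally show ?thesis by (simp add: in_U_def sandwich_def)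
  qed
  moreover have "in_U (k + 2) (x @ a # - 1 # - 1 # b # y)
      \<longleftrightarrow> hz * hz * unit_inv hu * unit_inv ht \<in> ?S"
  proof -
    have "hz ^ (k + 2) * word_val True (x @ a # - 1 # - 1 # b # y)
        = hz ^ k * (hz ^ 2 * p) * (unit_inv hu * unit_inv ht) * q"
      using assms by (simp add: word_val_append p_def q_def mult.assoc power_add del: power_Suc add_2_eq_Suc')
    also have "\<dots> = hz ^ k * (p * hz ^ 2) * (unit_inv hu * unit_inv ht) * q"
      by (simp only: comm)
    also have "\<dots> = hz ^ k * p * (hz * hz * unit_inv hu * unit_inv ht) * q"
      by (simp add: mult.assoc power2_eq_square)
    finally show ?thesis by (simp add: in_U_def sandwich_def)
  qed
  ultimately show
    "in_U (k + 1) (x @ a # b # y) \<Longrightarrow> in_U (k + 2) (x @ a # - 1 # - 1 # b # y)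
      \<Longrightarrow> in_U k (x @ (a + 1) # (b + 1) # y)"
    "in_U k (x @ (a + 1) # (b + 1) # y) \<Longrightarrow> in_U (k + 1) (x @ a # b # y)
      \<Longrightarrow> in_U (k + 2) (x @ a # - 1 # - 1 # b # y)"
    using quadratic_closure [OF S] by blast+
qed

section \<open>The rules for intervals of exponents of z\<close>

definition in_U_range :: "nat \<Rightarrow> nat \<Rightarrow> int list \<Rightarrow> bool" where
  "in_U_range l h w \<longleftrightarrow> (\<forall>k. l \<le> k \<and> k \<le> h \<longrightarrow> in_U k w)"

lemma in_U_rangeD: "in_U_range l h w \<Longrightarrow> norm_word v = w \<Longrightarrow> l \<le> k \<Longrightarrow> k \<le> h \<Longrightarrow> in_U k v"
  by (metis in_U_norm in_U_range_def)

lemma in_U_rangeI: "norm_word v = w \<Longrightarrow> (\<And>k. l \<le> k \<Longrightarrow> k \<le> h \<Longrightarrow> in_U k v) \<Longrightarrow> in_U_range l h w"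
  by (metis in_U_norm in_U_range_def)

text \<open>The second interval may start right after the first one ends; no overlap is
  required.\<close>

lemma in_U_range_join: "in_U_range l m w \<Longrightarrow> in_U_range l' h w \<Longrightarrow> l' \<le> Suc m \<Longrightarrow> in_U_range l h w"
  unfolding in_U_range_def by (metis le_trans not_less_eq_eq)

text \<open>Solves for the term with the lowest power of z, so the premises are needed one and two
  exponents higher. The equations for \<open>norm_word\<close> let the words be given in normal
  form.\<close>

lemma quadratic_up:
  assumes "in_U_range l1 h1 w1" "in_U_range l2 h2 w2"
    and "even (length x)" "norm_word (x @ a # b # y) = w1" "norm_word (x @ a # - 1 # - 1 # b # y) = w2"
    and "norm_word (x @ (a + 1) # (b + 1) # y) = w"
    and "l1 \<le> l + 1" "h + 1 \<le> h1" "l2 \<le> l + 2" "h + 2 \<le> h2"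
  shows "in_U_range l h w"
proof (rule in_U_rangeI [OF assms(6)])
  fix k assume k: "l \<le> k" "k \<le> h"
  show "in_U k (x @ (a + 1) # (b + 1) # y)"
    by (rule in_U_quadratic(1) [OF assms(3)
        in_U_rangeD [OF assms(1,4)] in_U_rangeD [OF assms(2,5)]])
      (use assms k in simp_all)
qed

text \<open>Solves for the term with the highest power of z. The premises sit one and two exponents
  lower, so the interval may extend above theirs.\<close>

lemma quadratic_down:
  assumes "in_U_range l1 h1 w1" "in_U_range l2 h2 w2"
    and "even (length x)" "norm_word (x @ (a + 1) # (b + 1) # y) = w1" "norm_word (x @ a # b # y) = w2"
    and "norm_word (x @ a # - 1 # - 1 # b # y) = w"
    and "2 \<le> l" "l1 + 2 \<le> l" "h \<le> h1 + 2" "l2 + 1 \<le> l" "h \<le> h2 + 1"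
  shows "in_U_range l h w"
proof (rule in_U_rangeI [OF assms(6)])
  fix k assume k: "l \<le> k" "k \<le> h"
  \<comment> \<open>The bound \<open>2 \<le> l\<close> keeps the subtraction of naturals from
    truncating.\<close>
  define j where "j = k - 2"
  have j: "k = j + 2" "2 \<le> k"
    using assms(7) k by (simp_all add: j_def)
  show "in_U k (x @ a # - 1 # - 1 # b # y)"
    unfolding j by (rule in_U_quadratic(2) [OF assms(3)
        in_U_rangeD [OF assms(1,4)] in_U_rangeD [OF assms(2,5)]])
      (use assms k j in simp_all)
qed

text \<open>All terms of this relation carry the same power of z, so the result holds on the common
  part of the intervals. The same applies to the next three rules.\<close>

lemma cubic_up:
  assumes "in_U_range l1 h1 w1" "in_U_range l2 h2 w2" "in_U_range l3 h3 w3"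
    and "even (length x)" "norm_word (x @ (a + 2) # y) = w1" "norm_word (x @ (a + 1) # y) = w2"
      "norm_word (x @ a # y) = w3" "norm_word (x @ (a + 3) # y) = w"
    and "l1 \<le> l" "h \<le> h1" "l2 \<le> l" "h \<le> h2" "l3 \<le> l" "h \<le> h3"
  shows "in_U_range l h w"
proof (rule in_U_rangeI [OF assms(8)])
  fix k assume k: "l \<le> k" "k \<le> h"
  show "in_U k (x @ (a + 3) # y)"
    by (rule in_U_cubic(1) [OF assms(4)
        in_U_rangeD [OF assms(1,5)] in_U_rangeD [OF assms(2,6)] in_U_rangeD [OF assms(3,7)]])
      (use assms k in simp_all)
qed

lemma cubic_down:
  assumes "in_U_range l1 h1 w1" "in_U_range l2 h2 w2" "in_U_range l3 h3 w3"
    and "even (length x)" "norm_word (x @ (a + 3) # y) = w1" "norm_word (x @ (a + 2) # y) = w2"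
      "norm_word (x @ (a + 1) # y) = w3" "norm_word (x @ a # y) = w"
    and "l1 \<le> l" "h \<le> h1" "l2 \<le> l" "h \<le> h2" "l3 \<le> l" "h \<le> h3"
  shows "in_U_range l h w"
proof (rule in_U_rangeI [OF assms(8)])
  fix k assume k: "l \<le> k" "k \<le> h"
  show "in_U k (x @ a # y)"
    by (rule in_U_cubic(2) [OF assms(4)
        in_U_rangeD [OF assms(1,5)] in_U_rangeD [OF assms(2,6)] in_U_rangeD [OF assms(3,7)]])
      (use assms k in simp_all)
qed

lemma quartic_up:
  assumes "in_U_range l1 h1 w1" "in_U_range l2 h2 w2" "in_U_range l3 h3 w3" "in_U_range l4 h4 w4"
    and "odd (length x)" "norm_word (x @ (a + 3) # y) = w1" "norm_word (x @ (a + 2) # y) = w2"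
      "norm_word (x @ (a + 1) # y) = w3" "norm_word (x @ a # y) = w4" "norm_word (x @ (a + 4) # y) = w"
    and "l1 \<le> l" "h \<le> h1" "l2 \<le> l" "h \<le> h2" "l3 \<le> l" "h \<le> h3" "l4 \<le> l" "h \<le> h4"
  shows "in_U_range l h w"
proof (rule in_U_rangeI [OF assms(10)])
  fix k assume k: "l \<le> k" "k \<le> h"
  show "in_U k (x @ (a + 4) # y)"
    by (rule in_U_quartic(1) [OF assms(5)
        in_U_rangeD [OF assms(1,6)] in_U_rangeD [OF assms(2,7)] in_U_rangeD [OF assms(3,8)] in_U_rangeD [OF assms(4,9)]])
      (use assms k in simp_all)
qed

lemma quartic_down:
  assumes "in_U_range l1 h1 w1" "in_U_range l2 h2 w2" "in_U_range l3 h3 w3" "in_U_range l4 h4 w4"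
    and "odd (length x)" "norm_word (x @ (a + 4) # y) = w1" "norm_word (x @ (a + 3) # y) = w2"
      "norm_word (x @ (a + 2) # y) = w3" "norm_word (x @ (a + 1) # y) = w4" "norm_word (x @ a # y) = w"
    and "l1 \<le> l" "h \<le> h1" "l2 \<le> l" "h \<le> h2" "l3 \<le> l" "h \<le> h3" "l4 \<le> l" "h \<le> h4"
  shows "in_U_range l h w"
proof (rule in_U_rangeI [OF assms(10)])
  fix k assume k: "l \<le> k" "k \<le> h"
  show "in_U k (x @ a # y)"
    by (rule in_U_quartic(2) [OF assms(5)
        in_U_rangeD [OF assms(1,6)] in_U_rangeD [OF assms(2,7)] in_U_rangeD [OF assms(3,8)] in_U_rangeD [OF assms(4,9)]])
      (use assms k in simp_all)
qed

lemmas norm_word_simps = norm_word_def strip_def push_def Let_def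

text \<open>The starting words 1 and \<open>ht * unit_inv hu\<close>, read off the two summands of
  each layer with trivial outer factors.\<close>

lemma mod_U_words: "in_U_range 0 23 []" "in_U_range 0 23 [1, -1]"
proof -
  have "1 \<in> alg_u3" "1 \<in> alg_u2"
    using subalgebra_alg by (auto simp: subalgebra_def)
  then show "in_U_range 0 23 []" "in_U_range 0 23 [1, -1]"
    using mod_U_base [of _ 1 1] by (auto simp: in_U_range_def in_U_def)
qed

text \<open>The steps below were found by a computer search that saturates the set of pairs of an exponent of z
  and a word of at most three syllables in each of t and u under the six rules above, and were then
  minimised.\<close>

lemma words_in_U:
  "in_U_range 0 23 [1, 1]" "in_U_range 0 23 [1, 2]" "in_U_range 0 23 [1, - 1, 1, - 1]"
  "in_U_range 0 23 [2, - 1]" "in_U_range 0 23 [1, 1, 1, - 1]" "in_U_range 0 23 [1, 2, 1, - 1]"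
proof -
  \<comment> \<open>All side conditions below are evaluations of normal forms, parities of lengths
    and inequalities between numerals.\<close>
  note norm_word_simps [simp]
  \<comment> \<open>The rule yields \<open>[0, - 1, - 1, - 1]\<close>, whose leading power of u is
    stripped; the premises \<open>[1, 0]\<close> and \<open>[0, - 1]\<close> both normalise to the
    empty word.\<close>
  have f1: "in_U_range 2 23 [- 1, - 1]"
    by (rule quadratic_down [where x = "[]" and a = 0 and b = "- 1" and y = "[]", OF mod_U_words(1) mod_U_words(1)])
      simp_all
  have f2: "in_U_range 2 23 [1, - 1, - 1, - 1]"
    by (rule quadratic_down [where x = "[]" and a = 1 and b = "- 1" and y = "[]", OF mod_U_words(1) mod_U_words(2)])
      simp_all
  have f3: "in_U_range 2 23 [2, - 1]"
    by (rule cubic_up [where x = "[]" and a = "- 1" and y = "[- 1]", OF mod_U_words(2) mod_U_words(1) f1])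
      simp_all
  have f4: "in_U_range 2 23 [- 1, - 2]"
    by (rule quadratic_down [where x = "[]" and a = 0 and b = "- 2" and y = "[]", OF mod_U_words(2) mod_U_words(1)])
      simp_all
  have f5: "in_U_range 0 19 [1, 1, 1, - 1]"
    by (rule quadratic_up [where x = "[]" and a = 0 and b = 0 and y = "[1, - 1]", OF mod_U_words(2) mod_U_words(1)])
      simp_all
  have f6: "in_U_range 0 21 [1, 1]"
    by (rule quadratic_up [where x = "[]" and a = 0 and b = 0 and y = "[]", OF mod_U_words(1) mod_U_words(1)])
      simp_all
  have f7: "in_U_range 4 23 [- 2, - 1]"
    by (rule cubic_down [where x = "[]" and a = "- 2" and y = "[- 1]", OF mod_U_words(2) mod_U_words(1) f1])
      simp_all
  have f8: "in_U_range 12 15 [1, - 1, - 1, - 1, - 1, - 1]"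
    by (rule quadratic_down [where x = "[]" and a = 1 and b = "- 1" and y = "[- 1, - 1]", OF mod_U_words(2) f2])
      simp_all
  have f9: "in_U_range 2 21 [1, 1, - 1, - 1]"
    by (rule quadratic_up [where x = "[]" and a = 0 and b = 0 and y = "[- 1, - 1]", OF f1 f7])
      simp_all
  have f10: "in_U_range 10 13 [- 1, - 1, - 2, - 1]"
    by (rule quadratic_down [where x = "[]" and a = 0 and b = "- 1" and y = "[- 2, - 1]", OF f1 f7])
      simp_all
  have f11: "in_U_range 0 19 [1, 2]"
    by (rule quadratic_up [where x = "[1, 2]" and a = 0 and b = "- 1" and y = "[]", OF f6 f9])
      simp_all
  have f12: "in_U_range 0 19 [1, - 2]"
    by (rule quartic_down [where x = "[1]" and a = "- 2" and y = "[]", OF f11 f6 mod_U_words(1) mod_U_words(2)])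
      simp_all
  have f13: "in_U_range 2 17 [1, 1, 1, 2]"
    by (rule quadratic_up [where x = "[]" and a = 0 and b = 0 and y = "[1, 2]", OF f11 mod_U_words(1)])
      simp_all
  have f14: "in_U_range 2 21 [- 1, 1]"
    by (rule quadratic_down [where x = "[]" and a = 0 and b = 1 and y = "[]", OF f11 mod_U_words(1)])
      simp_all
  have f15: "in_U_range 9 15 [1, - 1, 1, 1]"
    by (rule quadratic_up [where x = "[1, - 1]" and a = 0 and b = 0 and y = "[]", OF mod_U_words(2) f12])
      simp_all
  have f16: "in_U_range 3 19 [1, - 3]"
    by (rule quartic_down [where x = "[1]" and a = "- 3" and y = "[]", OF f6 mod_U_words(1) mod_U_words(2) f12])
      simp_all
  have f17: "in_U_range 4 17 [1, - 2, 1, 1]"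
    by (rule quadratic_up [where x = "[1, - 2]" and a = 0 and b = 0 and y = "[]", OF f12 f16])
      simp_all
  have f18: "in_U_range 2 21 [- 1, 2]"
    by (rule quartic_up [where x = "[- 1]" and a = "- 2" and y = "[]", OF f14 mod_U_words(1) f1 f4])
      simp_all
  have f19: "in_U_range 2 21 [- 2, 1]"
    by (rule cubic_down [where x = "[]" and a = "- 2" and y = "[1]", OF f6 mod_U_words(1) f14])
      simp_all
  have f20: "in_U_range 3 19 [1, - 2, - 1, - 1]"
    by (rule quadratic_down [where x = "[1, - 1]" and a = 0 and b = "- 1" and y = "[]", OF mod_U_words(2) f12])
      simp_all
  have f21: "in_U_range 2 19 [- 2, - 2]"
    by (rule cubic_down [where x = "[]" and a = "- 2" and y = "[- 2]", OF f12 mod_U_words(1) f4])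
      simp_all
  have f22: "in_U_range 4 18 [1, - 1, - 1, - 2]"
    by (rule quadratic_down [where x = "[]" and a = 1 and b = "- 2" and y = "[]", OF f3 f12])
      simp_all
  have f23: "in_U_range 1 13 [1, 1, - 1, 1]"
    by (rule quadratic_up [where x = "[]" and a = 0 and b = 0 and y = "[- 1, 1]", OF f14 f19])
      simp_all
  have f24: "in_U_range 3 15 [1, 1, - 2, - 1]"
    by (rule quadratic_down [where x = "[1, 1]" and a = "- 2" and b = 0 and y = "[]", OF f23 f6])
      simp_all
  have f25: "in_U_range 4 19 [- 1, 1, - 1, - 1]"
    by (rule quadratic_down [where x = "[- 1, 2]" and a = 0 and b = "- 1" and y = "[]", OF f18 f14])
      simp_all
  have f26: "in_U_range 1 17 [1, 1, - 1, - 2]"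
    by (rule quadratic_up [where x = "[]" and a = 0 and b = 0 and y = "[- 1, - 2]", OF f4 f21])
      simp_all
  have f27: "in_U_range 2 19 [2, 2]"
    by (rule cubic_up [where x = "[]" and a = "- 1" and y = "[2]", OF f11 mod_U_words(1) f18])
      simp_all
  have f28: "in_U_range 2 17 [- 1, 3]"
    by (rule quartic_up [where x = "[- 1]" and a = "- 1" and y = "[]", OF f18 f14 mod_U_words(1) f1])
      simp_all
  have f29: "in_U_range 4 7 [- 1, - 1, - 1, 2]"
    by (rule quadratic_down [where x = "[]" and a = "- 1" and b = 2 and y = "[]", OF mod_U_words(1) f18])
      simp_all
  have f30: "in_U_range 1 19 [- 1, 1, 1, 2]"
    by (rule quadratic_up [where x = "[]" and a = "- 2" and b = 0 and y = "[1, 2]", OF f18 f19])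
      simp_all
  have f31: "in_U_range 3 17 [1, 2, - 1, - 1]"
    by (rule quadratic_up [where x = "[]" and a = 0 and b = 1 and y = "[- 1, - 1]", OF f1 f25])
      simp_all
  have f32: "in_U_range 0 17 [1, 2, 1, 2]"
    by (rule quadratic_up [where x = "[]" and a = 0 and b = 1 and y = "[1, 2]", OF f11 f30])
      simp_all
  have f33: "in_U_range 7 8 [1, 1, 2, 2]"
    by (rule quadratic_up [where x = "[]" and a = 0 and b = 0 and y = "[2, 2]", OF f27 f11])
      simp_all
  have f34: "in_U_range 0 15 [1, 2, 1, - 1]"
    by (rule quadratic_up [where x = "[1, 2]" and a = 0 and b = "- 2" and y = "[]", OF mod_U_words(1) f26])
      simp_all
  have f35: "in_U_range 4 21 [1, - 1, - 1, 1]"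
    by (rule quadratic_down [where x = "[]" and a = 1 and b = 1 and y = "[]", OF f27 f6])
      simp_all
  have f36: "in_U_range 4 17 [- 1, - 1, 1, 2]"
    by (rule quadratic_down [where x = "[]" and a = 0 and b = "- 1" and y = "[1, 2]", OF f27 f11])
      simp_all
  have f37: "in_U_range 6 7 [- 1, - 1, 2, 2]"
    by (rule cubic_up [where x = "[- 1, - 1]" and a = "- 1" and y = "[2]", OF f36 f14 f29])
      simp_all
  have f38: "in_U_range 4 11 [1, - 1, - 1, 2]"
    by (rule quartic_up [where x = "[1, - 1, - 1]" and a = "- 2" and y = "[]", OF f35 mod_U_words(2) f2 f22])
      simp_all
  have f39: "in_U_range 9 12 [1, - 1, - 2, 1]"
    by (rule cubic_down [where x = "[1, - 1]" and a = "- 2" and y = "[1]", OF f15 mod_U_words(1) f35])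
      simp_all
  have f40: "in_U_range 6 23 [1, - 1, - 2, - 1]"
    by (rule quadratic_down [where x = "[1, - 1]" and a = "- 2" and b = 0 and y = "[]", OF f35 mod_U_words(2)])
      simp_all
  have f41: "in_U_range 3 15 [1, 2, - 2, - 1]"
    by (rule cubic_down [where x = "[1, 2]" and a = "- 2" and y = "[- 1]", OF f34 f6 f31])
      simp_all
  have f42: "in_U_range 6 7 [- 1, - 2, - 1, 2]"
    by (rule quadratic_down [where x = "[]" and a = 0 and b = "- 2" and y = "[- 1, 2]", OF f38 f18])
      simp_all
  have f43: "in_U_range 6 15 [1, - 2, - 2, - 1]"
    by (rule quartic_down [where x = "[1]" and a = "- 2" and y = "[- 2, - 1]", OF f41 f24 f1 f40])
      simp_all
  have f44: "in_U_range 12 15 [1, - 1, - 1, - 1, - 2, - 1]"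
    by (rule quadratic_down [where x = "[]" and a = 1 and b = "- 1" and y = "[- 2, - 1]", OF mod_U_words(1) f40])
      simp_all
  have f45: "in_U_range 10 13 [1, - 1, - 2, - 1, - 1, 1]"
    by (rule quadratic_down [where x = "[1, - 1]" and a = "- 2" and b = 1 and y = "[]", OF f38 f39])
      simp_all
  have f46: "in_U_range 6 17 [- 1, 1, - 2, - 1]"
    by (rule quadratic_down [where x = "[]" and a = 0 and b = 1 and y = "[- 2, - 1]", OF f41 f7])
      simp_all
  have f47: "in_U_range 6 19 [1, - 1, 1, - 1]"
    by (rule cubic_up [where x = "[1, - 1]" and a = "- 2" and y = "[- 1]", OF f12 f2 f40])
      simp_all
  have f48: "in_U_range 12 15 [1, - 1, - 2, - 1, - 2, - 1]"
    by (rule quadratic_down [where x = "[1, - 1, - 2, - 1]" and a = "- 2" and b = 0 and y = "[]", OF f45 f40])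
      simp_all
  have f49: "in_U_range 6 15 [1, 3, 1, - 1]"
    by (rule quartic_up [where x = "[1]" and a = "- 1" and y = "[1, - 1]", OF f34 f5 f3 f47])
      simp_all
  have f50: "in_U_range 4 13 [1, - 2, - 1, 1]"
    by (rule quadratic_up [where x = "[1, - 2]" and a = "- 2" and b = 0 and y = "[]", OF f12 f43])
      simp_all
  have f51: "in_U_range 12 15 [1, - 1, - 1, - 1, 1, - 1]"
    by (rule cubic_up [where x = "[1, - 1, - 1, - 1]" and a = "- 2" and y = "[- 1]", OF f22 f8 f44])
      simp_all
  have f52: "in_U_range 4 15 [- 1, 1, - 1, 1]"
    by (rule quadratic_up [where x = "[- 1, 1]" and a = "- 2" and b = 0 and y = "[]", OF f14 f46])
      simp_all
  have f53: "in_U_range 8 17 [- 1, 2, 1, - 1]"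
    by (rule quadratic_down [where x = "[]" and a = 0 and b = 2 and y = "[1, - 1]", OF f49 mod_U_words(2)])
      simp_all
  have f54: "in_U_range 2 11 [1, - 1, 1, 2]"
    by (rule quadratic_up [where x = "[1, - 1]" and a = 0 and b = 1 and y = "[]", OF mod_U_words(1) f50])
      simp_all
  have f55: "in_U_range 10 19 [- 1, 1, - 1, - 2]"
    by (rule quadratic_down [where x = "[- 1, 2]" and a = 0 and b = "- 2" and y = "[]", OF f53 mod_U_words(1)])
      simp_all
  have f56: "in_U_range 6 7 [- 1, - 2, 1, 2]"
    by (rule quadratic_down [where x = "[]" and a = 0 and b = "- 2" and y = "[1, 2]", OF f54 f11])
      simp_all
  have f57: "in_U_range 4 11 [- 2, - 1, 1, 2]"
    by (rule cubic_down [where x = "[]" and a = "- 2" and y = "[- 1, 1, 2]", OF f54 f11 f36])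
      simp_all
  have f58: "in_U_range 2 9 [- 1, 1, 2, 2]"
    by (rule quadratic_up [where x = "[]" and a = "- 2" and b = 0 and y = "[2, 2]", OF mod_U_words(1) f57])
      simp_all
  have f59: "in_U_range 10 15 [- 1, 1, - 1, 2]"
    by (rule quartic_up [where x = "[- 1, 1, - 1]" and a = "- 2" and y = "[]", OF f52 f14 f25 f55])
      simp_all
  have f60: "in_U_range 6 7 [- 1, - 2, 2, 2]"
    by (rule cubic_up [where x = "[- 1, - 2]" and a = "- 1" and y = "[2]", OF f56 mod_U_words(1) f42])
      simp_all
  have f61: "in_U_range 2 9 [- 1, 1, - 1, 2]"
    by (rule cubic_down [where x = "[- 1, 1]" and a = "- 1" and y = "[2]", OF f58 f30 f28])
      simp_all
  \<comment> \<open>Two derivations of one word cover the adjacent intervals 2 to 9 and 10 to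
    15.\<close>
  have f62: "in_U_range 2 15 [- 1, 1, - 1, 2]"
    by (rule in_U_range_join [OF f61 f59]) simp
  have f63: "in_U_range 4 15 [- 1, 1, - 1, - 2]"
    by (rule quartic_down [where x = "[- 1, 1, - 1]" and a = "- 2" and y = "[]", OF f62 f52 f14 f25])
      simp_all
  have f64: "in_U_range 2 15 [- 1, 1, 2, 2]"
    by (rule cubic_up [where x = "[- 1, 1]" and a = "- 1" and y = "[2]", OF f30 f28 f62])
      simp_all
  have f65: "in_U_range 4 17 [- 2, - 1, 1, 2]"
    by (rule quadratic_down [where x = "[]" and a = "- 2" and b = 0 and y = "[2, 2]", OF f64 mod_U_words(1)])
      simp_all
  have f66: "in_U_range 7 8 [- 2, 1, 2, 2]"
    by (rule cubic_down [where x = "[]" and a = "- 2" and y = "[1, 2, 2]", OF f33 f27 f58])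
      simp_all
  have f67: "in_U_range 4 19 [- 1, 1, - 1, - 2]"
    by (rule in_U_range_join [OF f63 f55]) simp
  have f68: "in_U_range 2 17 [- 1, 2, 1, - 1]"
    by (rule quadratic_up [where x = "[- 1, 2]" and a = 0 and b = "- 2" and y = "[]", OF mod_U_words(1) f67])
      simp_all
  have f69: "in_U_range 6 7 [- 1, 2, 2, 2]"
    by (rule quartic_up [where x = "[- 1]" and a = "- 2" and y = "[2, 2]", OF f58 f11 f37 f60])
      simp_all
  have f70: "in_U_range 8 9 [- 2, - 1, - 1, 1, 2, 2]"
    by (rule quadratic_down [where x = "[]" and a = "- 2" and b = 1 and y = "[2, 2]", OF f69 f66])
      simp_all
  have f71: "in_U_range 0 15 [1, 3, 1, - 1]"
    by (rule quadratic_up [where x = "[]" and a = 0 and b = 2 and y = "[1, - 1]", OF mod_U_words(2) f68])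
      simp_all
  have f72: "in_U_range 4 17 [1, - 1, 1, 2]"
    by (rule cubic_up [where x = "[]" and a = "- 2" and y = "[- 1, 1, 2]", OF f11 f36 f65])
      simp_all
  have f73: "in_U_range 8 11 [- 1, - 1, - 2, - 1, 1, 2]"
    by (rule quadratic_down [where x = "[]" and a = 0 and b = "- 1" and y = "[- 2, - 1, 1, 2]", OF f36 f57])
      simp_all
  have f74: "in_U_range 10 11 [- 2, - 1, - 2, - 1, 1, 2]"
    by (rule quadratic_down [where x = "[- 2, - 1]" and a = "- 2" and b = 0 and y = "[2, 2]", OF f70 f19])
      simp_all
  have f75: "in_U_range 10 11 [1, - 1, - 2, - 1, 1, 2]"
    by (rule cubic_up [where x = "[]" and a = "- 2" and y = "[- 1, - 2, - 1, 1, 2]", OF f57 f73 f74])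
      simp_all
  have f76: "in_U_range 2 17 [1, - 1, 1, 2]"
    by (rule in_U_range_join [OF f54 f72]) simp
  have f77: "in_U_range 2 17 [1, - 2, 1, 2]"
    by (rule quartic_down [where x = "[1]" and a = "- 2" and y = "[1, 2]", OF f32 f13 f27 f76])
      simp_all
  have f78: "in_U_range 2 15 [1, - 1, 1, - 1]"
    by (rule quartic_down [where x = "[1]" and a = "- 1" and y = "[1, - 1]", OF f71 f34 f5 f3])
      simp_all
  have f79: "in_U_range 4 19 [1, - 2, - 1, 1]"
    by (rule quadratic_down [where x = "[1, - 1]" and a = 0 and b = 1 and y = "[]", OF f76 mod_U_words(1)])
      simp_all
  have f80: "in_U_range 11 15 [1, - 1, 1, - 2]"
    by (rule quartic_down [where x = "[1, - 1, 1]" and a = "- 2" and y = "[]", OF f72 f15 mod_U_words(2) f47])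
      simp_all
  have f81: "in_U_range 2 19 [1, - 1, 1, - 1]"
    by (rule in_U_range_join [OF f78 f47]) simp
  have f82: "in_U_range 4 19 [1, - 2, - 1, - 2]"
    by (rule quadratic_down [where x = "[1, - 1]" and a = 0 and b = "- 2" and y = "[]", OF f81 f16])
      simp_all
  have f83: "in_U_range 11 15 [1, - 1, - 2, - 2]"
    by (rule cubic_down [where x = "[1, - 1]" and a = "- 2" and y = "[- 2]", OF f80 f16 f22])
      simp_all
  have f84: "in_U_range 12 15 [1, - 1, 1, - 3]"
    by (rule quartic_down [where x = "[1, - 1, 1]" and a = "- 3" and y = "[]", OF f15 mod_U_words(2) f47 f80])
      simp_all
  have f85: "in_U_range 16 20 [1, - 2, - 2, - 1]"
    by (rule quadratic_down [where x = "[1, - 2]" and a = "- 2" and b = 0 and y = "[]", OF f79 f12])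
      simp_all
  have f86: "in_U_range 12 15 [1, - 1, 1, 1, 1, - 1]"
    by (rule quadratic_up [where x = "[1, - 1]" and a = 0 and b = 0 and y = "[1, - 1]", OF f47 f16])
      simp_all
  have f87: "in_U_range 2 19 [1, - 1, - 2, - 1]"
    by (rule cubic_down [where x = "[1, - 1]" and a = "- 2" and y = "[- 1]", OF f81 f12 f2])
      simp_all
  have f88: "in_U_range 4 19 [1, - 2, - 1, 2]"
    by (rule quartic_up [where x = "[1, - 2, - 1]" and a = "- 2" and y = "[]", OF f79 f12 f20 f82])
      simp_all
  have f89: "in_U_range 12 15 [1, - 1, 1, - 2, - 1, - 1]"
    by (rule quadratic_down [where x = "[1, - 1, 1, - 1]" and a = 0 and b = "- 1" and y = "[]", OF f47 f80])
      simp_all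
  have f90: "in_U_range 12 13 [1, - 1, - 2, - 2, - 1, 1]"
    by (rule quadratic_down [where x = "[1, - 1, - 2, - 1]" and a = 0 and b = 1 and y = "[]", OF f75 mod_U_words(2)])
      simp_all
  have f91: "in_U_range 4 17 [1, - 2, - 2, 1]"
    by (rule cubic_down [where x = "[1, - 2]" and a = "- 2" and y = "[1]", OF f17 mod_U_words(2) f79])
      simp_all
  have f92: "in_U_range 12 15 [1, - 1, 2, - 1]"
    by (rule cubic_up [where x = "[1, - 1]" and a = "- 1" and y = "[- 1]", OF f47 f12 f2])
      simp_all
  have f93: "in_U_range 12 15 [1, - 1, - 2, - 1, - 1, - 1]"
    by (rule quadratic_down [where x = "[1, - 1]" and a = "- 2" and b = "- 1" and y = "[]", OF mod_U_words(2) f40])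
      simp_all
  have f94: "in_U_range 10 13 [2, - 1, - 2, - 1]"
    by (rule cubic_up [where x = "[]" and a = "- 1" and y = "[- 1, - 2, - 1]", OF f40 f7 f10])
      simp_all
  have f95: "in_U_range 4 17 [1, - 2, - 2, 2]"
    by (rule cubic_down [where x = "[1, - 2]" and a = "- 2" and y = "[2]", OF f77 mod_U_words(1) f88])
      simp_all
  have f96: "in_U_range 14 15 [1, - 1, - 2, - 2, - 2, - 1]"
    by (rule quadratic_down [where x = "[1, - 1, - 2, - 2]" and a = "- 2" and b = 0 and y = "[]", OF f90 f83])
      simp_all
  have f97: "in_U_range 12 15 [1, - 1, - 2, - 1, 1, - 1]"
    by (rule cubic_up [where x = "[1, - 1, - 2, - 1]" and a = "- 2" and y = "[- 1]", OF f83 f93 f48])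
      simp_all
  have f98: "in_U_range 2 3 [1, - 1, - 1, 1]"
    by (rule quadratic_up [where x = "[1, - 1]" and a = "- 2" and b = 0 and y = "[]", OF mod_U_words(2) f87])
      simp_all
  have f99: "in_U_range 3 15 [1, - 2, - 2, - 1]"
    by (rule quartic_down [where x = "[1]" and a = "- 2" and y = "[- 2, - 1]", OF f41 f24 f1 f87])
      simp_all
  have f100: "in_U_range 3 20 [1, - 2, - 2, - 1]"
    by (rule in_U_range_join [OF f99 f85]) simp
  have f101: "in_U_range 3 19 [1, - 2, 1, - 1]"
    by (rule cubic_up [where x = "[1, - 2]" and a = "- 2" and y = "[- 1]", OF f16 f20 f100])
      simp_all
  have f102: "in_U_range 12 15 [1, - 3, - 2, - 1]"
    by (rule quartic_down [where x = "[1]" and a = "- 3" and y = "[- 2, - 1]", OF f24 f1 f40 f43])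
      simp_all
  have f103: "in_U_range 12 15 [1, - 1, - 1, - 2, - 2, - 1]"
    by (rule quadratic_down [where x = "[]" and a = 1 and b = "- 2" and y = "[- 2, - 1]", OF f94 f43])
      simp_all
  have f104: "in_U_range 4 17 [1, - 2, - 2, - 2]"
    by (rule quartic_down [where x = "[1, - 2, - 2]" and a = "- 2" and y = "[]", OF f95 f91 f12 f100])
      simp_all
  have f105: "in_U_range 14 15 [1, - 1, 1, - 2, - 2, - 1]"
    by (rule cubic_up [where x = "[1, - 1]" and a = "- 2" and y = "[- 2, - 2, - 1]", OF f102 f103 f96])
      simp_all
  have f106: "in_U_range 3 19 [1, 2, 1, - 1]"
    by (rule quartic_up [where x = "[1]" and a = "- 2" and y = "[1, - 1]", OF f5 f3 f81 f101])
      simp_all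
  have f107: "in_U_range 12 15 [1, - 1, 1, - 1, 1, - 1]"
    by (rule cubic_up [where x = "[1, - 1]" and a = "- 2" and y = "[- 1, 1, - 1]", OF f101 f51 f97])
      simp_all
  have f108: "in_U_range 3 15 [1, - 1, 1, 1, - 1, - 2]"
    by (rule quadratic_up [where x = "[1, - 1]" and a = 0 and b = 0 and y = "[- 1, - 2]", OF f22 f104])
      simp_all
  have f109: "in_U_range 1 18 [1, - 2, - 1, 1]"
    by (rule quadratic_up [where x = "[1, - 2]" and a = "- 2" and b = 0 and y = "[]", OF f12 f100])
      simp_all
  have f110: "in_U_range 0 19 [1, 2, 1, - 1]"
    by (rule in_U_range_join [OF f34 f106]) simp
  have f111: "in_U_range 2 21 [1, 1, - 1, - 2]"
    by (rule quadratic_down [where x = "[1, 2]" and a = 0 and b = "- 2" and y = "[]", OF f110 mod_U_words(1)])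
      simp_all
  have f112: "in_U_range 0 3 [1, - 1, 1, 2]"
    by (rule quadratic_up [where x = "[1, - 1]" and a = 0 and b = 1 and y = "[]", OF mod_U_words(1) f109])
      simp_all
  have f113: "in_U_range 2 13 [1, 3, 1, - 1]"
    by (rule quartic_up [where x = "[1]" and a = "- 1" and y = "[1, - 1]", OF f34 f5 f3 f78])
      simp_all
  have f114: "in_U_range 14 15 [1, - 1, 1, - 2, 1, - 1]"
    by (rule cubic_up [where x = "[1, - 1, 1, - 2]" and a = "- 2" and y = "[- 1]", OF f84 f89 f105])
      simp_all
  have f115: "in_U_range 1 13 [1, - 1, 1, 2, 1, - 1]"
    by (rule quadratic_up [where x = "[1, - 1, 1, 2]" and a = 0 and b = "- 2" and y = "[]", OF mod_U_words(2) f108])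
      simp_all
  have f116: "in_U_range 4 17 [1, 2, - 2, - 1]"
    by (rule cubic_down [where x = "[1, 2]" and a = "- 2" and y = "[- 1]", OF f106 f6 f31])
      simp_all
  have f117: "in_U_range 14 15 [1, - 1, 1, 2, 1, - 1]"
    by (rule quartic_up [where x = "[1, - 1, 1]" and a = "- 2" and y = "[1, - 1]", OF f86 f92 f107 f114])
      simp_all
  have f118: "in_U_range 1 21 [1, 1, - 1, - 2]"
    by (rule in_U_range_join [OF f26 f111]) simp
  have f119: "in_U_range 3 23 [- 2, - 2]"
    by (rule quadratic_down [where x = "[]" and a = 0 and b = 0 and y = "[- 1, - 2]", OF f118 f4])
      simp_all
  have f120: "in_U_range 1 15 [1, - 1, 1, 2, 1, - 1]"
    by (rule in_U_range_join [OF f115 f117]) simp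
  have f121: "in_U_range 3 17 [1, - 1, 1, 1, - 1, - 2]"
    by (rule quadratic_down [where x = "[1, - 1, 1, 2]" and a = 0 and b = "- 2" and y = "[]", OF f120 mod_U_words(2)])
      simp_all
  have f122: "in_U_range 12 13 [1, - 1, 1, - 2, 1, - 1]"
    by (rule quartic_down [where x = "[1, - 1, 1]" and a = "- 2" and y = "[1, - 1]", OF f115 f86 f92 f107])
      simp_all
  have f123: "in_U_range 2 15 [- 1, 2, 1, - 1]"
    by (rule quadratic_down [where x = "[]" and a = 0 and b = 2 and y = "[1, - 1]", OF f71 mod_U_words(2)])
      simp_all
  have f124: "in_U_range 6 19 [- 1, 1, - 2, - 1]"
    by (rule quadratic_down [where x = "[]" and a = 0 and b = 1 and y = "[- 2, - 1]", OF f116 f7])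
      simp_all
  have f125: "in_U_range 4 17 [- 1, 1, - 1, 1]"
    by (rule quadratic_up [where x = "[- 1, 1]" and a = "- 2" and b = 0 and y = "[]", OF f14 f124])
      simp_all
  have f126: "in_U_range 12 13 [1, - 1, 1, - 2, - 2, - 1]"
    by (rule cubic_down [where x = "[1, - 1, 1, - 2]" and a = "- 2" and y = "[- 1]", OF f122 f84 f89])
      simp_all
  have f127: "in_U_range 5 19 [1, - 2, - 2, - 2]"
    by (rule quadratic_down [where x = "[1, - 1]" and a = 0 and b = 0 and y = "[- 1, - 2]", OF f121 f22])
      simp_all
  have f128: "in_U_range 2 23 [- 2, - 2]"
    by (rule in_U_range_join [OF f21 f119]) simp
  have f129: "in_U_range 2 23 [1, - 2]"
    by (rule cubic_up [where x = "[]" and a = "- 2" and y = "[- 2]", OF mod_U_words(1) f4 f128])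
      simp_all
  have f130: "in_U_range 4 17 [- 1, 1, - 1, - 2]"
    by (rule quadratic_down [where x = "[- 1, 2]" and a = 0 and b = "- 2" and y = "[]", OF f68 mod_U_words(1)])
      simp_all
  have f131: "in_U_range 4 17 [- 1, 1, - 1, 2]"
    by (rule quartic_up [where x = "[- 1, 1, - 1]" and a = "- 2" and y = "[]", OF f125 f14 f25 f67])
      simp_all
  have f132: "in_U_range 3 23 [1, - 2, - 1, - 1]"
    by (rule quadratic_down [where x = "[1, - 1]" and a = 0 and b = "- 1" and y = "[]", OF mod_U_words(2) f129])
      simp_all
  have f133: "in_U_range 4 19 [1, - 2, - 2, - 1]"
    by (rule quadratic_down [where x = "[1, - 2]" and a = "- 2" and b = 0 and y = "[]", OF f109 f12])
      simp_all
  have f134: "in_U_range 0 23 [1, - 2]"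
    by (rule in_U_range_join [OF f12 f129]) simp
  have f135: "in_U_range 0 21 [1, 2]"
    by (rule quartic_up [where x = "[1]" and a = "- 2" and y = "[]", OF f6 mod_U_words(1) mod_U_words(2) f134])
      simp_all
  have f136: "in_U_range 4 24 [1, - 1, - 1, - 2]"
    by (rule quadratic_down [where x = "[]" and a = 1 and b = "- 2" and y = "[]", OF f3 f129])
      simp_all
  have f137: "in_U_range 12 13 [1, - 1, - 2, - 2, - 2, - 1]"
    by (rule cubic_down [where x = "[1, - 1]" and a = "- 2" and y = "[- 2, - 2, - 1]", OF f126 f102 f103])
      simp_all
  have f138: "in_U_range 6 21 [1, - 3]"
    by (rule quartic_down [where x = "[1]" and a = "- 3" and y = "[]", OF f6 mod_U_words(1) mod_U_words(2) f129])
      simp_all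
  have f139: "in_U_range 2 23 [1, - 1, - 2, - 1]"
    by (rule in_U_range_join [OF f87 f40]) simp
  have f140: "in_U_range 2 23 [1, - 1, 1, - 1]"
    by (rule cubic_up [where x = "[1, - 1]" and a = "- 2" and y = "[- 1]", OF f129 f2 f139])
      simp_all
  have f141: "in_U_range 4 19 [1, - 2, 1, 1]"
    by (rule quadratic_up [where x = "[1, - 2]" and a = 0 and b = 0 and y = "[]", OF f129 f138])
      simp_all
  have f142: "in_U_range 10 11 [1, - 1, - 2, - 2, - 1, 1]"
    by (rule quadratic_up [where x = "[1, - 1, - 2, - 2]" and a = "- 2" and b = 0 and y = "[]", OF f83 f137])
      simp_all
  have f143: "in_U_range 2 21 [2, 2]"
    by (rule cubic_up [where x = "[]" and a = "- 1" and y = "[2]", OF f135 mod_U_words(1) f18])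
      simp_all
  have f144: "in_U_range 2 19 [1, 1, 1, 2]"
    by (rule quadratic_up [where x = "[]" and a = 0 and b = 0 and y = "[1, 2]", OF f135 mod_U_words(1)])
      simp_all
  have f145: "in_U_range 2 17 [- 1, 1, - 1, 2]"
    by (rule in_U_range_join [OF f62 f131]) simp
  have f146: "in_U_range 2 17 [- 1, 1, 2, 2]"
    by (rule cubic_up [where x = "[- 1, 1]" and a = "- 1" and y = "[2]", OF f30 f28 f145])
      simp_all
  have f147: "in_U_range 4 19 [- 1, - 1, 1, 2]"
    by (rule quadratic_down [where x = "[]" and a = 0 and b = "- 1" and y = "[1, 2]", OF f27 f11])
      simp_all
  have f148: "in_U_range 2 23 [- 1, 1]"
    by (rule quadratic_down [where x = "[]" and a = 0 and b = 1 and y = "[]", OF f135 mod_U_words(1)])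
      simp_all
  have f149: "in_U_range 4 19 [1, - 2, - 2, 1]"
    by (rule cubic_down [where x = "[1, - 2]" and a = "- 2" and y = "[1]", OF f141 mod_U_words(2) f79])
      simp_all
  have f150: "in_U_range 5 6 [1, 1, 2, 2]"
    by (rule quadratic_up [where x = "[]" and a = 0 and b = 0 and y = "[2, 2]", OF f27 f11])
      simp_all
  have f151: "in_U_range 4 5 [- 1, - 1, 2, 2]"
    by (rule cubic_up [where x = "[- 1, - 1]" and a = "- 1" and y = "[2]", OF f36 f14 f29])
      simp_all
  have f152: "in_U_range 8 9 [1, - 1, - 2, - 1, 1, 2]"
    by (rule quadratic_up [where x = "[1, - 1, - 2, - 1]" and a = 0 and b = 1 and y = "[]", OF mod_U_words(2) f142])
      simp_all
  have f153: "in_U_range 4 19 [- 2, - 1, 1, 2]"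
    by (rule quadratic_down [where x = "[]" and a = "- 2" and b = 0 and y = "[2, 2]", OF f146 mod_U_words(1)])
      simp_all
  have f154: "in_U_range 2 22 [- 1, 2]"
    by (rule quartic_up [where x = "[- 1]" and a = "- 2" and y = "[]", OF f148 mod_U_words(1) f1 f4])
      simp_all
  have f155: "in_U_range 5 6 [- 2, 1, 2, 2]"
    by (rule cubic_down [where x = "[]" and a = "- 2" and y = "[1, 2, 2]", OF f150 f27 f58])
      simp_all
  have f156: "in_U_range 4 19 [1, - 1, 1, 2]"
    by (rule cubic_up [where x = "[]" and a = "- 2" and y = "[- 1, 1, 2]", OF f11 f147 f153])
      simp_all
  have f157: "in_U_range 8 9 [- 2, - 1, - 2, - 1, 1, 2]"
    by (rule cubic_down [where x = "[]" and a = "- 2" and y = "[- 1, - 2, - 1, 1, 2]", OF f152 f57 f73])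
      simp_all
  have f158: "in_U_range 4 19 [1, - 2, - 2, - 2]"
    by (rule in_U_range_join [OF f104 f127]) simp
  have f159: "in_U_range 4 19 [1, - 2, - 2, 2]"
    by (rule quartic_up [where x = "[1, - 2, - 2]" and a = "- 2" and y = "[]", OF f149 f12 f100 f158])
      simp_all
  have f160: "in_U_range 4 19 [1, - 2, 1, 2]"
    by (rule cubic_up [where x = "[1, - 2]" and a = "- 2" and y = "[2]", OF mod_U_words(1) f88 f159])
      simp_all
  have f161: "in_U_range 2 19 [1, - 1, 1, 2]"
    by (rule in_U_range_join [OF f76 f156]) simp
  have f162: "in_U_range 2 19 [1, - 2, 1, 2]"
    by (rule in_U_range_join [OF f77 f160]) simp
  have f163: "in_U_range 2 19 [1, 2, 1, 2]"
    by (rule quartic_up [where x = "[1]" and a = "- 2" and y = "[1, 2]", OF f144 f27 f161 f162])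
      simp_all
  have f164: "in_U_range 4 5 [- 1, - 2, 1, 2]"
    by (rule quadratic_down [where x = "[]" and a = 0 and b = "- 2" and y = "[1, 2]", OF f54 f11])
      simp_all
  have f165: "in_U_range 6 7 [- 2, - 1, - 1, 1, 2, 2]"
    by (rule quadratic_up [where x = "[- 2, - 1]" and a = "- 2" and b = 0 and y = "[2, 2]", OF f19 f157])
      simp_all
  have f166: "in_U_range 0 19 [1, - 1, 1, 2]"
    by (rule in_U_range_join [OF f112 f156]) simp
  have f167: "in_U_range 2 21 [1, - 2, - 1, 1]"
    by (rule quadratic_down [where x = "[1, - 1]" and a = 0 and b = 1 and y = "[]", OF f166 mod_U_words(1)])
      simp_all
  have f168: "in_U_range 0 19 [1, 2, 1, 2]"
    by (rule in_U_range_join [OF f32 f163]) simp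
  have f169: "in_U_range 2 21 [- 1, 1, 1, 2]"
    by (rule quadratic_down [where x = "[]" and a = 0 and b = 1 and y = "[1, 2]", OF f168 f135])
      simp_all
  have f170: "in_U_range 4 5 [- 1, 2, 2, 2]"
    by (rule quadratic_up [where x = "[]" and a = "- 2" and b = 1 and y = "[2, 2]", OF f155 f165])
      simp_all
  have f171: "in_U_range 1 21 [1, - 2, - 1, 1]"
    by (rule in_U_range_join [OF f109 f167]) simp
  have f172: "in_U_range 3 23 [1, - 2, - 2, - 1]"
    by (rule quadratic_down [where x = "[1, - 2]" and a = "- 2" and b = 0 and y = "[]", OF f171 f129])
      simp_all
  have f173: "in_U_range 1 21 [- 1, 1, 1, 2]"
    by (rule in_U_range_join [OF f30 f169]) simp
  have f174: "in_U_range 3 23 [- 2, 1]"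
    by (rule quadratic_down [where x = "[]" and a = "- 2" and b = 0 and y = "[1, 2]", OF f173 f154])
      simp_all
  have f175: "in_U_range 4 5 [- 1, - 2, 2, 2]"
    by (rule quartic_down [where x = "[- 1]" and a = "- 2" and y = "[2, 2]", OF f170 f58 f11 f151])
      simp_all
  have f176: "in_U_range 4 5 [- 1, - 2, - 1, 2]"
    by (rule cubic_down [where x = "[- 1, - 2]" and a = "- 1" and y = "[2]", OF f175 f164 mod_U_words(1)])
      simp_all
  have f177: "in_U_range 2 23 [- 2, 1]"
    by (rule in_U_range_join [OF f19 f174]) simp
  have f178: "in_U_range 2 23 [1, 1]"
    by (rule cubic_up [where x = "[]" and a = "- 2" and y = "[1]", OF mod_U_words(1) f148 f177])
      simp_all
  have f179: "in_U_range 1 21 [1, 1, - 1, 1]"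
    by (rule quadratic_up [where x = "[]" and a = 0 and b = 0 and y = "[- 1, 1]", OF f148 f174])
      simp_all
  have f180: "in_U_range 2 3 [1, - 1, - 1, 2]"
    by (rule quadratic_up [where x = "[]" and a = 0 and b = "- 2" and y = "[- 1, 2]", OF f18 f176])
      simp_all
  have f181: "in_U_range 4 23 [1, - 1, - 1, 1]"
    by (rule quadratic_down [where x = "[]" and a = 1 and b = 1 and y = "[]", OF f143 f178])
      simp_all
  have f182: "in_U_range 0 23 [1, 1]"
    by (rule in_U_range_join [OF f6 f178]) simp
  \<comment> \<open>The exponents -2 to 1 of u after t are now available for all powers of z, and
    the quartic recurrence adds 2.\<close>
  have f183: "in_U_range 0 23 [1, 2]"
    by (rule quartic_up [where x = "[1]" and a = "- 2" and y = "[]", OF f182 mod_U_words(1) mod_U_words(2) f134])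
      simp_all
  have f184: "in_U_range 3 23 [1, - 3]"
    by (rule quartic_down [where x = "[1]" and a = "- 3" and y = "[]", OF f178 mod_U_words(1) mod_U_words(2) f129])
      simp_all
  have f185: "in_U_range 3 23 [1, 1, - 1, - 1]"
    by (rule quadratic_down [where x = "[1, 2]" and a = 0 and b = "- 1" and y = "[]", OF f135 f178])
      simp_all
  have f186: "in_U_range 3 23 [1, 1, - 2, - 1]"
    by (rule quadratic_down [where x = "[1, 1]" and a = "- 2" and b = 0 and y = "[]", OF f179 f178])
      simp_all
  have f187: "in_U_range 3 23 [1, 1, 1, - 1]"
    by (rule cubic_up [where x = "[1, 1]" and a = "- 2" and y = "[- 1]", OF mod_U_words(1) f185 f186])
      simp_all
  have f188: "in_U_range 4 23 [1, - 1, - 1, 2]"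
    by (rule quartic_up [where x = "[1, - 1, - 1]" and a = "- 2" and y = "[]", OF f181 mod_U_words(2) f2 f136])
      simp_all
  have f189: "in_U_range 2 23 [1, - 1, - 1, 2]"
    by (rule in_U_range_join [OF f180 f188]) simp
  have f190: "in_U_range 2 23 [1, - 1, - 1, 1]"
    by (rule in_U_range_join [OF f98 f181]) simp
  have f191: "in_U_range 2 23 [1, - 1, - 1, - 2]"
    by (rule quartic_down [where x = "[1, - 1, - 1]" and a = "- 2" and y = "[]", OF f189 f190 mod_U_words(2) f2])
      simp_all
  have f192: "in_U_range 3 23 [1, - 2, 1, - 1]"
    by (rule cubic_up [where x = "[1, - 2]" and a = "- 2" and y = "[- 1]", OF f184 f132 f172])
      simp_all
  have f193: "in_U_range 2 24 [1, - 1, - 1, - 2]"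
    by (rule in_U_range_join [OF f191 f136]) simp
  \<comment> \<open>This supplies the exponents 0 and 1 of z that \<open>f3\<close> lacks.\<close>
  have f194: "in_U_range 0 22 [2, - 1]"
    by (rule quadratic_up [where x = "[]" and a = 1 and b = "- 2" and y = "[]", OF f134 f193])
      simp_all
  have f195: "in_U_range 3 23 [1, 2, 1, - 1]"
    by (rule quartic_up [where x = "[1]" and a = "- 2" and y = "[1, - 1]", OF f187 f3 f140 f192])
      simp_all
  have f196: "in_U_range 0 23 [1, 2, 1, - 1]"
    by (rule in_U_range_join [OF f110 f195]) simp
  have f197: "in_U_range 0 23 [1, 1, 1, - 1]"
    by (rule in_U_range_join [OF f5 f187]) simp
  have f198: "in_U_range 2 23 [1, 3, 1, - 1]"
    by (rule quartic_up [where x = "[1]" and a = "- 1" and y = "[1, - 1]", OF f196 f197 f3 f140])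
      simp_all
  have f199: "in_U_range 0 23 [1, 3, 1, - 1]"
    by (rule in_U_range_join [OF f71 f198]) simp
  have f200: "in_U_range 0 23 [2, - 1]"
    by (rule in_U_range_join [OF f194 f3]) simp
  \<comment> \<open>In the family \<open>[1, j, 1, - 1]\<close> the cases 3, 2, 1, 0 of
    \<open>j\<close> give the case -1; for \<open>j = 0\<close> the word normalises to
    \<open>[2, - 1]\<close>.\<close>
  have f201: "in_U_range 0 23 [1, - 1, 1, - 1]"
    by (rule quartic_down [where x = "[1]" and a = "- 1" and y = "[1, - 1]", OF f199 f196 f197 f200])
      simp_all
  show "in_U_range 0 23 [1, 1]" "in_U_range 0 23 [1, 2]" "in_U_range 0 23 [1, - 1, 1, - 1]"
    "in_U_range 0 23 [2, - 1]" "in_U_range 0 23 [1, 1, 1, - 1]" "in_U_range 0 23 [1, 2, 1, - 1]"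
    by (fact f182 f183 f201 f200 f197 f196)+
qed

section \<open>Stability of U\<close>

text \<open>The span of the integer powers is closed under products because exponents add. Hence
  statements linear in an element of \<open>alg_u3\<close> need only be checked on powers of
  u.\<close>

lemma alg_u3_subset_span: "alg_u3 \<subseteq> hecke.span (range (int_pow hu))"
  unfolding alg_u3_def
proof (rule subalgebra_hull_subset)
  let ?P = "range (int_pow hu)"
  have pow: "int_pow hu i \<in> hecke.span ?P" for i
    by (simp add: hecke.span_base)
  from pow [of 0] show "1 \<in> hecke.span ?P"
    by simp
  from pow [of 1] show "hu \<in> hecke.span ?P"
    by simp
  show "x * y \<in> hecke.span ?P" if "x \<in> hecke.span ?P" "y \<in> hecke.span ?P" for x y
  proof -
    have "int_pow hu i * y \<in> hecke.span ?P" for i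
    proof -
      have "hecke.span ?P \<subseteq> {y. int_pow hu i * y \<in> hecke.span ?P}"
        by (intro hecke.span_minimal subspace_left_mult hecke.subspace_span)
          (auto simp: pow simp flip: pow_add)
      with that(2) show ?thesis by blast
    qed
    then have "hecke.span ?P \<subseteq> {x. x * y \<in> hecke.span ?P}"
      by (intro hecke.span_minimal subspace_right_mult hecke.subspace_span) auto
    with that(1) show ?thesis by blast
  qed
qed simp

text \<open>After moving \<open>ht\<close> past \<open>hz ^ k\<close> and discarding the right
  factor from \<open>alg_u2\<close>, what remains is linear in the factor from
  \<open>alg_u3\<close>. It is enough to test the exponents -1 to 2 of u, which are the words of
  \<open>words_in_U\<close> and \<open>mod_U_words\<close>.\<close>

lemma ht_left_stabilizes: "ht \<in> left_stabilizer mod_U"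
proof -
  have sub: "a \<in> S" if S: "hecke.subspace S" and "1 \<in> S" "hu \<in> S" "unit_inv hu \<in> S" "int_pow hu 2 \<in> S"
    and a: "a \<in> alg_u3" for S a
  proof -
    have "hecke.span (range (int_pow hu)) \<subseteq> S"
      using that by (intro hecke.span_minimal S) (auto intro: int_pow_mem(2))
    with a alg_u3_subset_span show ?thesis by blast
  qed
  have words: "in_U k [1, i]" "in_U k [1, i, 1, - 1]" if "k \<le> 23" "i \<in> {-1, 0, 1, 2}" for k i
  proof -
    \<comment> \<open>For exponent 0 the words are not in normal form and have to be traced back to
      known ones.\<close>
    have "in_U k [1, 0] = in_U k []" "in_U k [1, 0, 1, - 1] = in_U k [2, - 1]"
      by (simp_all add: norm_word_simps flip: in_U_norm [of k "[1, 0]"] in_U_norm [of k "[1, 0, 1, - 1]"])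
    then show "in_U k [1, i]" "in_U k [1, i, 1, - 1]"
      using mod_U_words words_in_U that by (auto simp: in_U_range_def)
  qed
  \<comment> \<open>These are claims (i) and (ii) on elements.\<close>
  have mem: "hz ^ k * ht * a \<in> mod_U" "hz ^ k * ht * a * (ht * unit_inv hu) \<in> mod_U"
    if "k \<le> 23" "a \<in> alg_u3" for k a
  proof -
    have "a \<in> sandwich (hz ^ k * ht) 1 mod_U"
      by (rule sub [OF subspace_sandwich [OF subspace_mod_U] _ _ _ _ that(2)])
        (use that words(1) [of k 0] words(1) [of k 1] words(1) [of k "- 1"] words(1) [of k 2]
          in \<open>simp_all add: sandwich_def in_U_def mult.assoc\<close>)
    moreover have "a \<in> sandwich (hz ^ k * ht) (ht * unit_inv hu) mod_U"
      by (rule sub [OF subspace_sandwich [OF subspace_mod_U] _ _ _ _ that(2)])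
        (use that words(2) [of k 0] words(2) [of k 1] words(2) [of k "- 1"] words(2) [of k 2]
          in \<open>simp_all add: sandwich_def in_U_def mult.assoc\<close>)
    ultimately show "hz ^ k * ht * a \<in> mod_U" "hz ^ k * ht * a * (ht * unit_inv hu) \<in> mod_U"
      by (simp_all add: sandwich_def)
  qed
  have "mod_U \<subseteq> {x. ht * x \<in> mod_U}"
  proof (rule mod_U_subset)
    show "hecke.subspace {x. ht * x \<in> mod_U}"
      by (rule subspace_left_mult [OF subspace_mod_U])
  next
    fix k a b assume *: "k \<le> (23::nat)" "a \<in> alg_u3" "b \<in> alg_u2"
    have "ht * hz ^ k = hz ^ k * ht"
      using hz_pow_commute(1) [of k 1] by simp
    then show "hz ^ k * a * b \<in> {x. ht * x \<in> mod_U}"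
      "hz ^ k * a * (ht * unit_inv hu) * b \<in> {x. ht * x \<in> mod_U}"
      using mem [OF *(1,2), THEN mod_U_right_mult [OF _ *(3)]] by (simp_all flip: mult.assoc)
  qed
  then show ?thesis
    by (auto simp: left_stabilizer_def)
qed

text \<open>On the lowest power of z the element s acts as the product of z and the inverses of u and t; on the
  other powers the quadratic relation expresses s z through z and t u, so the power of z does not
  increase.\<close>

lemma hs_left_stabilizes: "hs \<in> left_stabilizer mod_U"
proof -
  have stab: "subalgebra (left_stabilizer mod_U)"
    by (rule subalgebra_left_stabilizer [OF subspace_mod_U])
  have t: "alg_u2 \<subseteq> left_stabilizer mod_U"
    unfolding alg_u2_def using stab ht_left_stabilizes by (intro hull_minimal) auto
  have prod: "x * (y * w) \<in> mod_U" if "x \<in> left_stabilizer mod_U" "y \<in> left_stabilizer mod_U" "w \<in> mod_U" for x y w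
    using that by (simp add: left_stabilizer_def)
  have tu: "ht \<in> left_stabilizer mod_U" "unit_inv ht \<in> left_stabilizer mod_U"
      "hu \<in> left_stabilizer mod_U" "unit_inv hu \<in> left_stabilizer mod_U"
    using t alg_u3_left_stabilizes int_pow_mem_alg [of 1] int_pow_mem_alg [of "- 1"] by auto
  obtain c1 c0 d where c: "hz * hz * unit_inv hu * unit_inv ht = c1 *\<^sub>H hz + c0 *\<^sub>H (ht * hu)"
    by (rule hecke_quadratic)
  \<comment> \<open>The hypothesis covers all \<open>j\<close> because the exponent changes: from 0
    it moves to 1, and otherwise both \<open>k\<close> and \<open>k - 1\<close> occur.\<close>
  have key: "hs * (hz ^ k * y) \<in> mod_U" if "k \<le> 23" and y: "\<And>j. j \<le> 23 \<Longrightarrow> hz ^ j * y \<in> mod_U" for k y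
  proof (cases k)
    case 0
    have "hz * (unit_inv ht * w) = unit_inv ht * (hz * w)"
      "hz * (unit_inv hu * w) = unit_inv hu * (hz * w)" for w
      using hz_pow_commute(1) [of 1 "- 1"] hz_pow_commute(2) [of 1 "- 1"]
      by (simp_all flip: mult.assoc)
    then have "unit_inv hu * (unit_inv ht * (hz ^ 1 * y)) = hs * y"
      by (simp add: hs_eq mult.assoc)
    moreover have "unit_inv hu * (unit_inv ht * (hz ^ 1 * y)) \<in> mod_U"
      using tu y [of 1] by (intro prod) auto
    ultimately show ?thesis
      using 0 by simp
  next
    case (Suc n)
    have "hz ^ k * y \<in> mod_U" "hz ^ n * y \<in> mod_U"
      using that(1) by (auto intro: y simp: Suc simp del: power_Suc)
    then have mem: "c1 *\<^sub>H (hz ^ k * y) + c0 *\<^sub>H (ht * (hu * (hz ^ n * y))) \<in> mod_U"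
      by (intro hecke.subspace_add hecke.subspace_scale subspace_mod_U prod tu)
    have "hs * hz = c1 *\<^sub>H hz + c0 *\<^sub>H (ht * hu)"
      using c hz_central(1) by (simp add: hs_eq mult.assoc)
    then have "hs * (hz ^ k * y) = (c1 *\<^sub>H hz + c0 *\<^sub>H (ht * hu)) * (hz ^ n * y)"
      by (simp add: Suc flip: mult.assoc)
    also have "\<dots> = c1 *\<^sub>H (hz ^ k * y) + c0 *\<^sub>H (ht * (hu * (hz ^ n * y)))"
      by (simp add: Suc distrib_right hecke_scale_mult mult.assoc)
    finally show ?thesis
      using mem by simp
  qed
  have "mod_U \<subseteq> {x. hs * x \<in> mod_U}"
  proof (rule mod_U_subset)
    show "hecke.subspace {x. hs * x \<in> mod_U}"
      by (rule subspace_left_mult [OF subspace_mod_U])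
  next
    fix k a b assume *: "k \<le> (23::nat)" "a \<in> alg_u3" "b \<in> alg_u2"
    have "hs * (hz ^ k * (a * b)) \<in> mod_U" "hs * (hz ^ k * (a * (ht * unit_inv hu) * b)) \<in> mod_U"
      using mod_U_base [OF _ *(2,3)] by (intro key [OF *(1)]; simp add: mult.assoc)+
    then show "hz ^ k * a * b \<in> {x. hs * x \<in> mod_U}"
      "hz ^ k * a * (ht * unit_inv hu) * b \<in> {x. hs * x \<in> mod_U}"
      by (simp_all add: mult.assoc)
  qed
  then show ?thesis
    by (auto simp: left_stabilizer_def)
qed

theorem theorem4p3p23:
  shows "(\<forall>k\<in>{0..23::nat}. {hz ^ k * ht} \<odot> alg_u3 \<subseteq> mod_U) \<and>
         (\<forall>k\<in>{0..23::nat}. {hz ^ k * ht} \<odot> alg_u3 \<odot> {ht * unit_inv hu} \<subseteq> mod_U) \<and>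
         (UNIV :: hecke set) = mod_U"
proof -
  have stab: "subalgebra (left_stabilizer mod_U)"
    by (rule subalgebra_left_stabilizer [OF subspace_mod_U])
  have "left_stabilizer mod_U = UNIV"
    using alg_u3_left_stabilizes gen_mem_alg(2) ht_left_stabilizes hs_left_stabilizes
    by (intro generators_generate [OF stab]) auto
  then have "x \<in> left_stabilizer mod_U" for x
    by simp
  moreover have "1 \<in> mod_U"
    using mod_U_words(1) by (auto simp: in_U_range_def in_U_def dest: spec [of _ 0])
  ultimately have "x * 1 \<in> mod_U" for x
    unfolding left_stabilizer_def by blast
  then have "mod_U = UNIV" by auto
  \<comment> \<open>Once U is the whole algebra, the inclusions (i) and (ii) are immediate.\<close>
  then show ?thesis by simp
qed

end
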